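(* A bounded operator $T$ on $H^2(\mathbb G)$ is a Toeplitz operator (i.e. $T=T_\varphi$ for some $\varphi\in L^\infty(b\Gamma)$) if and only if it satisfies the Brown-Halmos relations with respect to $(T_s,T_p)$, that is, $$T_s^*TT_p=TT_s\quad\text{and}\quad T_p^*TT_p=T.$$
   Context: $\mathbb D$ is the open unit disc, $\mathbb T$ the unit circle, $m$ the product of normalized arc length measures on $\mathbb T^2=\mathbb T\times\mathbb T$. Let $\pi(z_1,z_2)=(z_1+z_2,z_1z_2)$, $J(z_1,z_2)=z_1-z_2$, $\|J\|^2=\int_{\mathbb T^2}|J|^2dm=2$, $\mathbb G=\pi(\mathbb D^2)$ and $b\Gamma=\pi(\mathbb T^2)$, with coordinates denoted $(s,p)$. Let $\nu$ be the Borel measure on $b\Gamma$ given by $\nu(E)=\int_{\pi^{-1}(E)}|J|^2dm$. $L^2(b\Gamma)$ is the Hilbert space of ($\nu$-a.e. classes of) functions on $b\Gamma$ with $\int|f|^2d\nu<\infty$, with norm $\|f\|^2=\|J\|^{-2}\int_{b\Gamma}|f|^2d\nu$; $L^\infty(b\Gamma)$ is the space of essentially bounded functions. $L^2_{\rm anti}(\mathbb T^2)=\{f\in L^2(\mathbb T^2):f(\zeta_1,\zeta_2)=-f(\zeta_2,\zeta_1)\text{ a.e.}\}$, and $U:L^2(b\Gamma)\to L^2_{\rm anti}(\mathbb T^2)$ is the unitary $Uf=\frac1{\|J\|}J\,(f\circ\pi)$. $H^2(\mathbb G)$ is the Hilbert space of holomorphic $f$ on $\mathbb G$ with $\|f\|=\|J\|^{-1}\{\sup_{0<r<1}\int_{\mathbb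 T^2}|f\circ\pi(r\zeta)|^2|J(r\zeta)|^2dm(\zeta)\}^{1/2}<\infty$; via boundary values it is identified with the closed subspace of those $f\in L^2(b\Gamma)$ for which $Uf$ has Fourier coefficients supported on $\{(i,j):i,j\ge0\}$. $Pr$ is the orthogonal projection of $L^2(b\Gamma)$ onto $H^2(\mathbb G)$. For $\varphi\in L^\infty(b\Gamma)$, $M_\varphi$ is multiplication by $\varphi$ on $L^2(b\Gamma)$ and the Toeplitz operator $T_\varphi$ on $H^2(\mathbb G)$ is $T_\varphi f=Pr\,M_\varphi f$. $T_s$ and $T_p$ are the Toeplitz operators with the coordinate functions $s$ and $p$ as symbols. *)

theory Defs
  imports "HOL-Probability.Probability"
begin

section \<open>The symmetrized torus and its measure\<close>

abbreviation unit_circle :: "complex set" where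
  "unit_circle \<equiv> sphere 0 1"

definition arc_measure :: "complex measure" where
  "arc_measure =
     distr (uniform_measure lborel {0..2 * pi}) (restrict_space borel unit_circle) cis"

definition torus_measure :: "(complex \<times> complex) measure" where
  "torus_measure = arc_measure \<Otimes>\<^sub>M arc_measure"

text \<open>The map usually called \<open>\<pi>\<close>; \<^const>\<open>pi\<close> denotes the real number.\<close>

definition symm_map :: "complex \<times> complex \<Rightarrow> complex \<times> complex" where
  "symm_map z = (fst z + snd z, fst z * snd z)"

definition jac :: "complex \<times> complex \<Rightarrow> complex" where
  "jac z = fst z - snd z"

definition jac_norm :: real where
  "jac_norm = sqrt (LINT z|torus_measure. (cmod (jac z))\<^sup>2)"

definition bGamma :: "(complex \<times> complex) set" where
  "bGamma = symm_map ` (unit_circle \<times> unit_circle)"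

definition nu :: "(complex \<times> complex) measure" where
  "nu = distr (density torus_measure (\<lambda>z. ennreal ((cmod (jac z))\<^sup>2)))
          (restrict_space borel bGamma) symm_map"

lemma cis_measurable [measurable]:
  "cis \<in> measurable (uniform_measure lborel {0..2 * pi}) (restrict_space borel unit_circle)"
proof (rule measurable_restrict_space2)
  have "cis \<in> borel_measurable borel"
    by (intro borel_measurable_continuous_onI continuous_intros)
  then show "cis \<in> borel_measurable (uniform_measure lborel {0..2 * pi})"
    by (simp add: measurable_def uniform_measure_def)
qed auto

lemma space_arc_measure [simp]: "space arc_measure = unit_circle"
  by (simp add: arc_measure_def space_restrict_space)

lemma sets_arc_measure: "sets arc_measure = sets (restrict_space borel unit_circle)"
  by (simp add: arc_measure_def)

lemma prob_space_arc_measure: "prob_space arc_measure"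
  unfolding arc_measure_def
proof (rule prob_space.prob_space_distr)
  show "prob_space (uniform_measure lborel {0..2 * pi})"
    by (rule prob_space_uniform_measure) auto
qed measurable

interpretation arc: prob_space arc_measure
  by (rule prob_space_arc_measure)

interpretation torus: pair_prob_space arc_measure arc_measure ..

lemma space_torus_measure [simp]: "space torus_measure = unit_circle \<times> unit_circle"
  by (simp add: torus_measure_def space_pair_measure)

lemma prob_space_torus_measure: "prob_space torus_measure"
  unfolding torus_measure_def by unfold_locales

lemma arc_borel_measurable:
  "f \<in> borel_measurable borel \<Longrightarrow> f \<in> borel_measurable arc_measure"
  by (subst measurable_cong_sets[OF sets_arc_measure refl]) (rule measurable_restrict_space1)

lemma fst_torus_measurable [measurable]: "fst \<in> borel_measurable torus_measure"
  and snd_torus_measurable [measurable]: "snd \<in> borel_measurable torus_measure"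
proof -
  have id: "(\<lambda>x. x) \<in> borel_measurable arc_measure"
    by (rule arc_borel_measurable) simp
  show "fst \<in> borel_measurable torus_measure"
    using measurable_compose[OF measurable_fst id] by (simp add: torus_measure_def)
  show "snd \<in> borel_measurable torus_measure"
    using measurable_compose[OF measurable_snd id] by (simp add: torus_measure_def)
qed

lemma jac_measurable [measurable]: "jac \<in> borel_measurable torus_measure"
  unfolding jac_def by measurable

lemma symm_map_measurable [measurable]:
  "symm_map \<in> measurable torus_measure (restrict_space borel bGamma)"
proof (rule measurable_restrict_space2)
  have "(\<lambda>z. (fst z + snd z, fst z * snd z)) \<in> measurable torus_measure (borel \<Otimes>\<^sub>M borel)"
    by measurable
  then show "symm_map \<in> borel_measurable torus_measure"
    by (simp add: symm_map_def[abs_def] borel_prod)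
qed (auto simp: bGamma_def)

lemma space_nu [simp]: "space nu = bGamma"
  by (simp add: nu_def space_restrict_space)

lemma sets_nu: "sets nu = sets (restrict_space borel bGamma)"
  by (simp add: nu_def)

lemma emeasure_nu:
  assumes "E \<in> sets nu"
  shows "emeasure nu E =
    (\<integral>\<^sup>+z\<in>symm_map -` E \<inter> unit_circle \<times> unit_circle.
       ennreal ((cmod (jac z))\<^sup>2) \<partial>torus_measure)"
proof -
  have E: "E \<in> sets (restrict_space borel bGamma)"
    using assms by (simp add: sets_nu)
  have "symm_map -` E \<inter> unit_circle \<times> unit_circle \<in> sets torus_measure"
    using measurable_sets[OF symm_map_measurable E] by simp
  then show ?thesis
    using E by (simp add: nu_def emeasure_distr emeasure_density)
qed

lemma integrable_nu_iff:
  fixes f :: "complex \<times> complex \<Rightarrow> real"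
  assumes "f \<in> borel_measurable nu"
  shows "integrable nu f \<longleftrightarrow>
    integrable torus_measure (\<lambda>z. (cmod (jac z))\<^sup>2 * f (symm_map z))"
proof -
  have f [measurable]: "f \<in> borel_measurable (restrict_space borel bGamma)"
    using assms by (simp add: measurable_cong_sets[OF sets_nu refl])
  have fs [measurable]: "(\<lambda>z. f (symm_map z)) \<in> borel_measurable torus_measure"
    by measurable
  have "integrable nu f \<longleftrightarrow>
    integrable (density torus_measure (\<lambda>z. ennreal ((cmod (jac z))\<^sup>2))) (\<lambda>z. f (symm_map z))"
    unfolding nu_def by (rule integrable_distr_eq) auto
  also have "\<dots> \<longleftrightarrow> integrable torus_measure (\<lambda>z. (cmod (jac z))\<^sup>2 *\<^sub>R f (symm_map z))"
    by (rule integrable_density) auto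
  finally show ?thesis by simp
qed

lemma AE_nuD:
  assumes "AE x in nu. P x" and [measurable]: "Measurable.pred nu P"
  shows "AE z in torus_measure. jac z = 0 \<or> P (symm_map z)"
proof -
  have m: "{x \<in> space (restrict_space borel bGamma). P x} \<in> sets (restrict_space borel bGamma)"
    using assms(2) by (simp add: pred_def sets_nu space_restrict_space)
  have "AE z in density torus_measure (\<lambda>z. ennreal ((cmod (jac z))\<^sup>2)). P (symm_map z)"
    using assms(1) m unfolding nu_def by (subst (asm) AE_distr_iff) auto
  then show ?thesis
    by (subst (asm) AE_density) (auto elim: eventually_mono)
qed

lemma arc_integral_id: "(LINT w|arc_measure. w) = 0"
proof -
  have dens: "indicator {0..2*pi} t / emeasure lborel {0..2*pi} =
      ennreal (indicator {0..2*pi} t / (2*pi))" for t :: real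
    by (auto simp: indicator_def divide_ennreal simp flip: ennreal_1)
  have c: "cis \<in> borel_measurable borel"
    by (intro borel_measurable_continuous_onI continuous_intros)
  have "(LINT w|arc_measure. w) = (LINT t|uniform_measure lborel {0..2 * pi}. cis t)"
    unfolding arc_measure_def
    by (rule integral_distr) (auto intro: measurable_restrict_space1)
  also have "\<dots> = (LINT t|lborel. (indicator {0..2*pi} t / (2 * pi)) *\<^sub>R cis t)"
    unfolding uniform_measure_def dens
    by (rule integral_density) (use c in auto)
  also have "\<dots> = (LINT t|lborel. (1 / (2 * pi)) *\<^sub>R (indicator {0..2*pi} t *\<^sub>R cis t))"
    by (intro Bochner_Integration.integral_cong) (auto simp: indicator_def)
  also have "\<dots> = (1 / (2 * pi)) *\<^sub>R (LINT t|lborel. indicator {0..2*pi} t *\<^sub>R cis t)"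
    by (rule integral_scaleR_right)
  also have "(LINT t|lborel. indicator {0..2*pi} t *\<^sub>R cis t) =
      - \<i> * cis (2*pi) - (- \<i> * cis 0)"
  proof (rule integral_FTC_Icc)
    fix t :: real
    have "((\<lambda>t. - \<i> * cis t) has_vector_derivative - \<i> * (\<i> * cis t)) (at t within {0..2*pi})"
      unfolding cis_conv_exp
      by (auto intro!: derivative_eq_intros has_vector_derivative_real_field simp: mult.assoc)
    then show "((\<lambda>t. - \<i> * cis t) has_vector_derivative cis t) (at t within {0..2*pi})"
      by simp
  qed (auto intro!: continuous_intros)
  finally show ?thesis by simp
qed

lemma borel_measurable_cnj [measurable (raw)]:
  "f \<in> borel_measurable M \<Longrightarrow> (\<lambda>x. cnj (f x)) \<in> borel_measurable M"
  by (rule borel_measurable_continuous_on) (auto intro!: continuous_intros)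

lemma jac_norm_eq: "jac_norm = sqrt 2"
proof -
  interpret t: prob_space torus_measure by (rule prob_space_torus_measure)
  have int: "integrable torus_measure (\<lambda>z. fst z * cnj (snd z))"
    by (rule t.integrable_const_bound[where B = 1])
       (auto intro!: AE_I2 borel_measurable_times borel_measurable_cnj simp: norm_mult)
  have "(LINT z|torus_measure. fst z * cnj (snd z)) =
      (LINT a|arc_measure. LINT b|arc_measure. a * cnj b)"
    using torus.integral_fst'[OF int[unfolded torus_measure_def]]
    by (simp add: torus_measure_def)
  also have "\<dots> = 0"
    by (simp add: arc_integral_id)
  finally have 0: "(LINT z|torus_measure. fst z * cnj (snd z)) = 0" .
  have "(LINT z|torus_measure. (cmod (jac z))\<^sup>2) =
      (LINT z|torus_measure. 2 - 2 * Re (fst z * cnj (snd z)))"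
  proof (rule Bochner_Integration.integral_cong[OF refl])
    fix z assume z: "z \<in> space torus_measure"
    have "(cmod (fst z))\<^sup>2 = 1" "(cmod (snd z))\<^sup>2 = 1"
      using z by (auto simp: mem_Times_iff)
    then have "(Re (fst z))\<^sup>2 + (Im (fst z))\<^sup>2 = 1" "(Re (snd z))\<^sup>2 + (Im (snd z))\<^sup>2 = 1"
      by (simp_all only: cmod_power2)
    then show "(cmod (jac z))\<^sup>2 = 2 - 2 * Re (fst z * cnj (snd z))"
      by (simp add: jac_def cmod_power2 power2_diff)
  qed
  also have "\<dots> = 2 - 2 * Re (LINT z|torus_measure. fst z * cnj (snd z))"
    using int by (simp add: t.prob_space[unfolded space_torus_measure] del: times_complex.simps complex_cnj_mult)
  finally show ?thesis
    by (simp add: jac_norm_def 0)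
qed

lemma jac_norm_pos: "jac_norm > 0"
  by (simp add: jac_norm_eq)


section \<open>The space \<open>L\<^sup>2\<close> of the symmetrized torus\<close>

definition square_integrable :: "(complex \<times> complex \<Rightarrow> complex) \<Rightarrow> bool" where
  "square_integrable f \<longleftrightarrow>
     f \<in> borel_measurable nu \<and> integrable nu (\<lambda>x. (cmod (f x))\<^sup>2)"

definition L2_rel ::
  "(complex \<times> complex \<Rightarrow> complex) \<Rightarrow> (complex \<times> complex \<Rightarrow> complex) \<Rightarrow> bool" where
  "L2_rel f g \<longleftrightarrow> square_integrable f \<and> square_integrable g \<and> (AE x in nu. f x = g x)"

lemma square_integrable_zero: "square_integrable (\<lambda>_. 0)"
  by (simp add: square_integrable_def)

lemma square_integrable_mult:
  assumes "\<phi> \<in> borel_measurable nu" "AE x in nu. cmod (\<phi> x) \<le> C" "square_integrable f"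
  shows "square_integrable (\<lambda>x. \<phi> x * f x)"
  unfolding square_integrable_def
proof
  have [measurable]: "f \<in> borel_measurable nu" "\<phi> \<in> borel_measurable nu"
    using assms by (auto simp: square_integrable_def)
  show "(\<lambda>x. \<phi> x * f x) \<in> borel_measurable nu"
    by measurable
  have "integrable nu (\<lambda>x. C\<^sup>2 * (cmod (f x))\<^sup>2)"
    using assms by (simp add: square_integrable_def)
  then show "integrable nu (\<lambda>x. (cmod (\<phi> x * f x))\<^sup>2)"
  proof (rule Bochner_Integration.integrable_bound)
    show "AE x in nu. norm ((cmod (\<phi> x * f x))\<^sup>2) \<le> norm (C\<^sup>2 * (cmod (f x))\<^sup>2)"
      using assms(2)
      by eventually_elim (auto simp: norm_mult power_mult_distrib intro!: mult_right_mono power_mono)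
  qed measurable
qed

lemma square_integrable_scale:
  "square_integrable f \<Longrightarrow> square_integrable (\<lambda>x. c * f x)"
  by (rule square_integrable_mult[where C = "cmod c"]) auto

lemma square_integrable_add:
  assumes "square_integrable f" "square_integrable g"
  shows "square_integrable (\<lambda>x. f x + g x)"
  unfolding square_integrable_def
proof
  have [measurable]: "f \<in> borel_measurable nu" "g \<in> borel_measurable nu"
    using assms by (auto simp: square_integrable_def)
  show "(\<lambda>x. f x + g x) \<in> borel_measurable nu"
    by measurable
  have "integrable nu (\<lambda>x. 2 * (cmod (f x))\<^sup>2 + 2 * (cmod (g x))\<^sup>2)"
    using assms by (simp add: square_integrable_def)
  then show "integrable nu (\<lambda>x. (cmod (f x + g x))\<^sup>2)"
  proof (rule Bochner_Integration.integrable_bound)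
    show "AE x in nu. norm ((cmod (f x + g x))\<^sup>2)
        \<le> norm (2 * (cmod (f x))\<^sup>2 + 2 * (cmod (g x))\<^sup>2)"
    proof (rule AE_I2)
      fix x
      have "(cmod (f x + g x))\<^sup>2 \<le> (cmod (f x) + cmod (g x))\<^sup>2"
        by (intro power_mono norm_triangle_ineq) auto
      also have "\<dots> \<le> 2 * (cmod (f x))\<^sup>2 + 2 * (cmod (g x))\<^sup>2"
        using sum_squares_bound[of "cmod (f x)" "cmod (g x)"] by (simp add: power2_sum)
      finally show "norm ((cmod (f x + g x))\<^sup>2)
          \<le> norm (2 * (cmod (f x))\<^sup>2 + 2 * (cmod (g x))\<^sup>2)"
        by simp
    qed
  qed measurable
qed

lemma square_integrable_uminus: "square_integrable f \<Longrightarrow> square_integrable (\<lambda>x. - f x)"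
  using square_integrable_scale[of f "-1"] by simp

lemma square_integrable_diff:
  "square_integrable f \<Longrightarrow> square_integrable g \<Longrightarrow> square_integrable (\<lambda>x. f x - g x)"
  using square_integrable_add[of f "\<lambda>x. - g x"] square_integrable_uminus[of g] by simp

lemma integrable_cinner:
  assumes "square_integrable f" "square_integrable g"
  shows "integrable nu (\<lambda>x. f x * cnj (g x))"
proof -
  have [measurable]: "f \<in> borel_measurable nu" "g \<in> borel_measurable nu"
    using assms by (auto simp: square_integrable_def)
  have "integrable nu (\<lambda>x. (cmod (f x))\<^sup>2 + (cmod (g x))\<^sup>2)"
    using assms by (simp add: square_integrable_def)
  then show ?thesis
  proof (rule Bochner_Integration.integrable_bound)
    show "AE x in nu. norm (f x * cnj (g x)) \<le> norm ((cmod (f x))\<^sup>2 + (cmod (g x))\<^sup>2)"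
    proof (rule AE_I2)
      fix x
      have "cmod (f x) * cmod (g x) \<le> 2 * cmod (f x) * cmod (g x)"
        by simp
      also have "\<dots> \<le> (cmod (f x))\<^sup>2 + (cmod (g x))\<^sup>2"
        by (rule sum_squares_bound)
      finally show "norm (f x * cnj (g x)) \<le> norm ((cmod (f x))\<^sup>2 + (cmod (g x))\<^sup>2)"
        by (simp add: norm_mult)
    qed
  qed (intro borel_measurable_times borel_measurable_cnj; measurable)
qed

text \<open>
  Representatives are total functions on pairs of complex numbers, but only their values on
  \<^term>\<open>bGamma\<close> matter, since \<^prop>\<open>space nu = bGamma\<close>.
\<close>

quotient_type L2_bGamma = "complex \<times> complex \<Rightarrow> complex" / partial: L2_rel
proof (rule part_equivpI)
  show "\<exists>f. L2_rel f f"
    using square_integrable_zero by (auto simp: L2_rel_def)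
  show "symp L2_rel"
    by (rule sympI) (auto simp: L2_rel_def elim: eventually_mono)
  show "transp L2_rel"
    by (rule transpI) (auto simp: L2_rel_def elim: AE_mp)
qed

lift_definition scaleC_L2 :: "complex \<Rightarrow> L2_bGamma \<Rightarrow> L2_bGamma" is "\<lambda>c f x. c * f x"
  by (auto simp: L2_rel_def square_integrable_scale)

lift_definition cinner_L2 :: "L2_bGamma \<Rightarrow> L2_bGamma \<Rightarrow> complex" is
  "\<lambda>f g. (LINT x|nu. f x * cnj (g x)) / (of_real jac_norm)\<^sup>2"
proof -
  fix f f' g g' assume *: "L2_rel f f'" "L2_rel g g'"
  have "(LINT x|nu. f x * cnj (g x)) = (LINT x|nu. f' x * cnj (g' x))"
  proof (rule integral_cong_AE)
    have "AE x in nu. f x = f' x" "AE x in nu. g x = g' x"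
      using * by (auto simp: L2_rel_def)
    then show "AE x in nu. f x * cnj (g x) = f' x * cnj (g' x)"
      by eventually_elim simp
  qed (use * in \<open>auto simp: L2_rel_def intro!: borel_measurable_integrable integrable_cinner\<close>)
  then show "(LINT x|nu. f x * cnj (g x)) / (of_real jac_norm)\<^sup>2
      = (LINT x|nu. f' x * cnj (g' x)) / (of_real jac_norm)\<^sup>2"
    by simp
qed

instantiation L2_bGamma :: real_inner
begin

lift_definition zero_L2_bGamma :: L2_bGamma is "\<lambda>_. 0"
  by (simp add: L2_rel_def square_integrable_zero)

lift_definition plus_L2_bGamma :: "L2_bGamma \<Rightarrow> L2_bGamma \<Rightarrow> L2_bGamma" is "\<lambda>f g x. f x + g x"
  by (auto simp: L2_rel_def square_integrable_add elim: AE_mp)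

lift_definition minus_L2_bGamma :: "L2_bGamma \<Rightarrow> L2_bGamma \<Rightarrow> L2_bGamma" is "\<lambda>f g x. f x - g x"
  by (auto simp: L2_rel_def square_integrable_diff elim: AE_mp)

lift_definition uminus_L2_bGamma :: "L2_bGamma \<Rightarrow> L2_bGamma" is "\<lambda>f x. - f x"
  by (auto simp: L2_rel_def square_integrable_uminus elim: AE_mp)

lift_definition norm_L2_bGamma :: "L2_bGamma \<Rightarrow> real" is
  "\<lambda>f. sqrt ((LINT x|nu. (cmod (f x))\<^sup>2) / jac_norm\<^sup>2)"
proof -
  fix f g assume *: "L2_rel f g"
  have "(LINT x|nu. (cmod (f x))\<^sup>2) = (LINT x|nu. (cmod (g x))\<^sup>2)"
    by (rule integral_cong_AE) (use * in \<open>auto simp: L2_rel_def square_integrable_def elim: eventually_mono\<close>)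
  then show "sqrt ((LINT x|nu. (cmod (f x))\<^sup>2) / jac_norm\<^sup>2)
      = sqrt ((LINT x|nu. (cmod (g x))\<^sup>2) / jac_norm\<^sup>2)"
    by simp
qed

definition scaleR_L2_bGamma :: "real \<Rightarrow> L2_bGamma \<Rightarrow> L2_bGamma" where
  "scaleR_L2_bGamma r = scaleC_L2 (of_real r)"

definition inner_L2_bGamma :: "L2_bGamma \<Rightarrow> L2_bGamma \<Rightarrow> real" where
  "inner_L2_bGamma f g = Re (cinner_L2 f g)"

definition sgn_L2_bGamma :: "L2_bGamma \<Rightarrow> L2_bGamma" where
  "sgn_L2_bGamma f = inverse (norm f) *\<^sub>R f"

definition dist_L2_bGamma :: "L2_bGamma \<Rightarrow> L2_bGamma \<Rightarrow> real" where
  "dist_L2_bGamma f g = norm (f - g)"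

definition uniformity_L2_bGamma :: "(L2_bGamma \<times> L2_bGamma) filter" where
  "uniformity_L2_bGamma = (INF e\<in>{0<..}. principal {(f, g). dist f g < e})"

definition open_L2_bGamma :: "L2_bGamma set \<Rightarrow> bool" where
  "open_L2_bGamma S \<longleftrightarrow> (\<forall>f\<in>S. \<forall>\<^sub>F (f', g) in uniformity. f' = f \<longrightarrow> g \<in> S)"

lemma cinner_L2_commute: "cinner_L2 f g = cnj (cinner_L2 g f)"
proof transfer
  fix f g
  have "(LINT x|nu. f x * cnj (g x)) = (LINT x|nu. cnj (g x * cnj (f x)))"
    by (simp add: mult.commute)
  also have "\<dots> = cnj (LINT x|nu. g x * cnj (f x))"
    by (rule integral_bounded_linear'[OF bounded_linear_cnj bounded_linear_cnj]) simp
  finally show "(LINT x|nu. f x * cnj (g x)) / (of_real jac_norm)\<^sup>2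
      = cnj ((LINT x|nu. g x * cnj (f x)) / (of_real jac_norm)\<^sup>2)"
    by simp
qed

lemma cinner_L2_add_left: "cinner_L2 (f + g) h = cinner_L2 f h + cinner_L2 g h"
  by transfer (auto simp: L2_rel_def distrib_right integrable_cinner simp flip: add_divide_distrib)

lemma cinner_L2_scaleC_left: "cinner_L2 (scaleC_L2 c f) g = c * cinner_L2 f g"
  by transfer (simp add: mult.assoc)

lemma cinner_L2_self: "cinner_L2 f f = of_real ((norm f)\<^sup>2)"
proof transfer
  fix f
  have "(LINT x|nu. f x * cnj (f x)) = (LINT x|nu. complex_of_real ((cmod (f x))\<^sup>2))"
    by (simp only: complex_norm_square)
  also have "\<dots> = of_real (LINT x|nu. (cmod (f x))\<^sup>2)"
    by (rule integral_complex_of_real)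
  finally show "(LINT x|nu. f x * cnj (f x)) / (of_real jac_norm)\<^sup>2
      = of_real ((sqrt ((LINT x|nu. (cmod (f x))\<^sup>2) / jac_norm\<^sup>2))\<^sup>2)"
    by simp
qed

lemma norm_L2_eq_zero:
  fixes f :: L2_bGamma
  assumes "norm f = 0"
  shows "f = 0"
  using assms
proof transfer
  fix f assume f: "L2_rel f f" and *: "sqrt ((LINT x|nu. (cmod (f x))\<^sup>2) / jac_norm\<^sup>2) = 0"
  have "(LINT x|nu. (cmod (f x))\<^sup>2) = 0"
    using * jac_norm_pos by simp
  then have "AE x in nu. (cmod (f x))\<^sup>2 = 0"
    using f by (subst (asm) integral_nonneg_eq_0_iff_AE) (auto simp: L2_rel_def square_integrable_def)
  then show "L2_rel f (\<lambda>_. 0)"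
    using f square_integrable_zero by (auto simp: L2_rel_def)
qed

instance
proof
  fix f g h :: L2_bGamma and a b :: real
  show "f + g + h = f + (g + h)"
    by transfer (auto simp: L2_rel_def add.assoc square_integrable_add)
  show "f + g = g + f"
    by transfer (auto simp: L2_rel_def add.commute square_integrable_add)
  show "0 + f = f"
    by transfer (auto simp: L2_rel_def)
  show "- f + f = 0"
    by transfer (auto simp: L2_rel_def square_integrable_zero)
  show "f - g = f + - g"
    by transfer (auto simp: L2_rel_def square_integrable_diff)
  show "a *\<^sub>R (f + g) = a *\<^sub>R f + a *\<^sub>R g"
    unfolding scaleR_L2_bGamma_def
    by transfer (auto simp: L2_rel_def distrib_left square_integrable_add square_integrable_scale)
  show "(a + b) *\<^sub>R f = a *\<^sub>R f + b *\<^sub>R f"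
    unfolding scaleR_L2_bGamma_def
    by transfer (auto simp: L2_rel_def distrib_right square_integrable_add square_integrable_scale)
  show "a *\<^sub>R b *\<^sub>R f = (a * b) *\<^sub>R f"
    unfolding scaleR_L2_bGamma_def
    by transfer (auto simp: L2_rel_def mult.assoc square_integrable_scale)
  show "1 *\<^sub>R f = f"
    unfolding scaleR_L2_bGamma_def by transfer (auto simp: L2_rel_def)
  show "f \<bullet> g = g \<bullet> f"
    unfolding inner_L2_bGamma_def by (subst cinner_L2_commute) simp
  show "(f + g) \<bullet> h = f \<bullet> h + g \<bullet> h"
    by (simp add: inner_L2_bGamma_def cinner_L2_add_left)
  show "a *\<^sub>R f \<bullet> g = a * (f \<bullet> g)"
    by (simp add: inner_L2_bGamma_def scaleR_L2_bGamma_def cinner_L2_scaleC_left)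
  show "0 \<le> f \<bullet> f"
    by (simp add: inner_L2_bGamma_def cinner_L2_self)
  have 0: "norm (0::L2_bGamma) = 0"
    by transfer simp
  show "f \<bullet> f = 0 \<longleftrightarrow> f = 0"
    using 0 norm_L2_eq_zero[of f] by (auto simp: inner_L2_bGamma_def cinner_L2_self)
  have "norm f \<ge> 0"
    by transfer simp
  then show "norm f = sqrt (f \<bullet> f)"
    by (simp add: inner_L2_bGamma_def cinner_L2_self)
qed (simp_all add: dist_L2_bGamma_def sgn_L2_bGamma_def uniformity_L2_bGamma_def open_L2_bGamma_def)

end


section \<open>The Hardy space as a closed subspace\<close>

definition unitary_U ::
  "(complex \<times> complex \<Rightarrow> complex) \<Rightarrow> (complex \<times> complex \<Rightarrow> complex)" where
  "unitary_U f z = (1 / of_real jac_norm) * jac z * f (symm_map z)"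

definition fourier_coeff :: "(complex \<times> complex \<Rightarrow> complex) \<Rightarrow> int \<Rightarrow> int \<Rightarrow> complex" where
  "fourier_coeff g i j =
     (LINT z|torus_measure. g z * cnj ((fst z powi i) * (snd z powi j)))"

lemma symm_map_compose_measurable:
  assumes "f \<in> borel_measurable nu"
  shows "(\<lambda>z. f (symm_map z)) \<in> borel_measurable torus_measure"
proof -
  have "f \<in> borel_measurable (restrict_space borel bGamma)"
    using assms by (simp add: measurable_cong_sets[OF sets_nu refl])
  then show ?thesis
    by (rule measurable_compose[OF symm_map_measurable])
qed

lemma unitary_U_measurable:
  "f \<in> borel_measurable nu \<Longrightarrow> unitary_U f \<in> borel_measurable torus_measure"
  unfolding unitary_U_def[abs_def]
  by (intro borel_measurable_times symm_map_compose_measurable) auto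

lemma unitary_U_cong_AE:
  assumes "L2_rel f g"
  shows "AE z in torus_measure. unitary_U f z = unitary_U g z"
proof -
  have [measurable]: "f \<in> borel_measurable nu" "g \<in> borel_measurable nu"
    using assms by (auto simp: L2_rel_def square_integrable_def)
  have "AE z in torus_measure. jac z = 0 \<or> f (symm_map z) = g (symm_map z)"
    using assms by (intro AE_nuD) (auto simp: L2_rel_def)
  then show ?thesis
    by eventually_elim (auto simp: unitary_U_def)
qed

lemma monomial_torus_measurable [measurable]:
  "(\<lambda>z. cnj ((fst z powi i) * (snd z powi j))) \<in> borel_measurable torus_measure"
  unfolding power_int_def
  by (intro borel_measurable_cnj borel_measurable_times) (auto split: if_splits)

lemma integrable_fourier:
  assumes "square_integrable f"
  shows "integrable torus_measure (\<lambda>z. unitary_U f z * cnj ((fst z powi i) * (snd z powi j)))"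
proof -
  interpret t: prob_space torus_measure by (rule prob_space_torus_measure)
  have f: "f \<in> borel_measurable nu"
    using assms by (simp add: square_integrable_def)
  note [measurable] = f unitary_U_measurable[OF f]
  have "integrable torus_measure (\<lambda>z. (cmod (jac z))\<^sup>2 * (cmod (f (symm_map z)))\<^sup>2)"
    using assms by (subst integrable_nu_iff[symmetric]) (auto simp: square_integrable_def)
  then have "integrable torus_measure
      (\<lambda>z. (1 / jac_norm)\<^sup>2 * ((cmod (jac z))\<^sup>2 * (cmod (f (symm_map z)))\<^sup>2) + 1)"
    by (intro Bochner_Integration.integrable_add integrable_mult_right) auto
  then show ?thesis
  proof (rule Bochner_Integration.integrable_bound)
    show "AE z in torus_measure. norm (unitary_U f z * cnj ((fst z powi i) * (snd z powi j)))
      \<le> norm ((1 / jac_norm)\<^sup>2 * ((cmod (jac z))\<^sup>2 * (cmod (f (symm_map z)))\<^sup>2) + 1)"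
    proof (rule AE_I2)
      fix z assume z: "z \<in> space torus_measure"
      have *: "t \<le> t\<^sup>2 + 1" if "t \<ge> 0" for t :: real
        using sum_squares_bound[of t 1] that by simp
      have "norm (unitary_U f z * cnj ((fst z powi i) * (snd z powi j))) = cmod (unitary_U f z)"
        using z by (auto simp: norm_mult norm_power_int)
      also have "\<dots> \<le> (cmod (unitary_U f z))\<^sup>2 + 1"
        by (rule *) simp
      also have "(cmod (unitary_U f z))\<^sup>2 =
          (1 / jac_norm)\<^sup>2 * ((cmod (jac z))\<^sup>2 * (cmod (f (symm_map z)))\<^sup>2)"
        using jac_norm_pos
        by (simp add: unitary_U_def norm_mult norm_divide power_mult_distrib power_divide)
      finally show "norm (unitary_U f z * cnj ((fst z powi i) * (snd z powi j)))
          \<le> norm ((1 / jac_norm)\<^sup>2 * ((cmod (jac z))\<^sup>2 * (cmod (f (symm_map z)))\<^sup>2) + 1)"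
        by simp
    qed
  qed measurable
qed

lift_definition fourier_U :: "L2_bGamma \<Rightarrow> int \<Rightarrow> int \<Rightarrow> complex" is
  "\<lambda>f. fourier_coeff (unitary_U f)"
proof (intro ext)
  fix f g i j assume *: "L2_rel f g"
  show "fourier_coeff (unitary_U f) i j = fourier_coeff (unitary_U g) i j"
    unfolding fourier_coeff_def
  proof (rule integral_cong_AE)
    show "AE z in torus_measure. unitary_U f z * cnj ((fst z powi i) * (snd z powi j))
        = unitary_U g z * cnj ((fst z powi i) * (snd z powi j))"
      using unitary_U_cong_AE[OF *] by eventually_elim simp
  qed (use * in \<open>auto simp: L2_rel_def simp del: complex_cnj_mult complex_cnj_power_int
          intro!: borel_measurable_integrable integrable_fourier\<close>)
qed

lemma fourier_U_zero: "fourier_U 0 i j = 0"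
  by transfer (simp add: fourier_coeff_def unitary_U_def)

lemma fourier_U_add: "fourier_U (f + g) i j = fourier_U f i j + fourier_U g i j"
proof transfer
  fix f g i j assume "L2_rel f f" "L2_rel g g"
  then have i: "integrable torus_measure (\<lambda>z. unitary_U f z * cnj ((fst z powi i) * (snd z powi j)))"
      "integrable torus_measure (\<lambda>z. unitary_U g z * cnj ((fst z powi i) * (snd z powi j)))"
    by (auto simp: L2_rel_def simp del: complex_cnj_mult intro!: integrable_fourier)
  have "unitary_U (\<lambda>x. f x + g x) = (\<lambda>z. unitary_U f z + unitary_U g z)"
    by (auto simp: unitary_U_def algebra_simps)
  then show "fourier_coeff (unitary_U (\<lambda>x. f x + g x)) i j =
      fourier_coeff (unitary_U f) i j + fourier_coeff (unitary_U g) i j"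
    unfolding fourier_coeff_def
    by (simp only: distrib_right Bochner_Integration.integral_add[OF i])
qed

lemma fourier_U_scaleC: "fourier_U (scaleC_L2 c f) i j = c * fourier_U f i j"
proof transfer
  fix c f i j
  have "unitary_U (\<lambda>x. c * f x) = (\<lambda>z. c * unitary_U f z)"
    by (auto simp: unitary_U_def algebra_simps)
  then show "fourier_coeff (unitary_U (\<lambda>x. c * f x)) i j = c * fourier_coeff (unitary_U f) i j"
    by (simp add: fourier_coeff_def mult.assoc)
qed

text \<open>
  The Hardy space of the symmetrized bidisc is represented by the boundary values of its elements,
  that is, as the subspace of those \<open>f\<close> in \<open>L\<^sup>2\<close> for which all
  Fourier coefficients of \<open>U f\<close> with a negative index vanish; \<open>of_H2\<close> is the
  inclusion. Making it a type of its own turns operators on it into plain functions.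
\<close>

typedef H2_G = "{f. \<forall>i j. i < 0 \<or> j < 0 \<longrightarrow> fourier_U f i j = 0}"
  morphisms of_H2 Abs_H2
  by (rule exI[of _ 0]) (simp add: fourier_U_zero)

setup_lifting type_definition_H2_G

lemma uminus_L2_conv: "- f = scaleC_L2 (-1) f"
  by transfer (auto simp: L2_rel_def square_integrable_uminus)

lift_definition scaleC_H2 :: "complex \<Rightarrow> H2_G \<Rightarrow> H2_G" is scaleC_L2
  by (simp add: fourier_U_scaleC)

lift_definition cinner_H2 :: "H2_G \<Rightarrow> H2_G \<Rightarrow> complex" is cinner_L2 .

instantiation H2_G :: real_inner
begin

lift_definition zero_H2_G :: H2_G is 0
  by (simp add: fourier_U_zero)

lift_definition plus_H2_G :: "H2_G \<Rightarrow> H2_G \<Rightarrow> H2_G" is "(+)"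
  by (simp add: fourier_U_add)

lift_definition uminus_H2_G :: "H2_G \<Rightarrow> H2_G" is uminus
  by (simp add: uminus_L2_conv fourier_U_scaleC)

lift_definition minus_H2_G :: "H2_G \<Rightarrow> H2_G \<Rightarrow> H2_G" is "(-)"
  by (simp only: diff_conv_add_uminus uminus_L2_conv fourier_U_scaleC fourier_U_add) simp

lift_definition scaleR_H2_G :: "real \<Rightarrow> H2_G \<Rightarrow> H2_G" is scaleR
  by (simp add: scaleR_L2_bGamma_def fourier_U_scaleC)

lift_definition norm_H2_G :: "H2_G \<Rightarrow> real" is norm .

lift_definition inner_H2_G :: "H2_G \<Rightarrow> H2_G \<Rightarrow> real" is inner .

definition sgn_H2_G :: "H2_G \<Rightarrow> H2_G" where
  "sgn_H2_G f = inverse (norm f) *\<^sub>R f"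

definition dist_H2_G :: "H2_G \<Rightarrow> H2_G \<Rightarrow> real" where
  "dist_H2_G f g = norm (f - g)"

definition uniformity_H2_G :: "(H2_G \<times> H2_G) filter" where
  "uniformity_H2_G = (INF e\<in>{0<..}. principal {(f, g). dist f g < e})"

definition open_H2_G :: "H2_G set \<Rightarrow> bool" where
  "open_H2_G S \<longleftrightarrow> (\<forall>f\<in>S. \<forall>\<^sub>F (f', g) in uniformity. f' = f \<longrightarrow> g \<in> S)"

instance
proof
  fix f g h :: H2_G and a b :: real
  show "f + g + h = f + (g + h)" by transfer (simp add: add.assoc)
  show "f + g = g + f" by transfer (simp add: add.commute)
  show "0 + f = f" by transfer simp
  show "- f + f = 0" by transfer simp
  show "f - g = f + - g" by transfer simp
  show "a *\<^sub>R (f + g) = a *\<^sub>R f + a *\<^sub>R g" by transfer (simp add: scaleR_add_right)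
  show "(a + b) *\<^sub>R f = a *\<^sub>R f + b *\<^sub>R f" by transfer (simp add: scaleR_add_left)
  show "a *\<^sub>R b *\<^sub>R f = (a * b) *\<^sub>R f" by transfer simp
  show "1 *\<^sub>R f = f" by transfer simp
  show "f \<bullet> g = g \<bullet> f" by transfer (simp add: inner_commute)
  show "(f + g) \<bullet> h = f \<bullet> h + g \<bullet> h" by transfer (simp add: inner_add_left)
  show "a *\<^sub>R f \<bullet> g = a * (f \<bullet> g)" by transfer simp
  show "0 \<le> f \<bullet> f" by transfer simp
  show "f \<bullet> f = 0 \<longleftrightarrow> f = 0" by transfer simp
  show "norm f = sqrt (f \<bullet> f)" by transfer (simp add: norm_eq_sqrt_inner)
qed (simp_all add: dist_H2_G_def sgn_H2_G_def uniformity_H2_G_def open_H2_G_def)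

end


section \<open>Toeplitz operators\<close>

text \<open>\<^const>\<open>bounded_linear\<close> gives real linearity only; complex homogeneity is added.\<close>

definition bounded_operator :: "(H2_G \<Rightarrow> H2_G) \<Rightarrow> bool" where
  "bounded_operator T \<longleftrightarrow> bounded_linear T \<and> (\<forall>c f. T (scaleC_H2 c f) = scaleC_H2 c (T f))"

definition adjoint_H2 :: "(H2_G \<Rightarrow> H2_G) \<Rightarrow> H2_G \<Rightarrow> H2_G" where
  "adjoint_H2 S = (THE S'. \<forall>f g. cinner_H2 (S f) g = cinner_H2 f (S' g))"

text \<open>The orthogonal projection: \<open>Pr f\<close> is the \<open>h\<close> in the subspace with \<open>f - h\<close> orthogonal to it.\<close>

definition Pr :: "L2_bGamma \<Rightarrow> H2_G" where
  "Pr f = (THE h. \<forall>g. cinner_L2 (f - of_H2 h) (of_H2 g) = 0)"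

definition Linfty_bGamma :: "(complex \<times> complex \<Rightarrow> complex) set" where
  "Linfty_bGamma = {\<phi> \<in> borel_measurable nu. \<exists>C. AE x in nu. cmod (\<phi> x) \<le> C}"

text \<open>Symbols are functions rather than a.e. classes; outside \<open>L\<^sup>\<infinity>\<close> the value 0 is a dummy.\<close>

lift_definition mult_op :: "(complex \<times> complex \<Rightarrow> complex) \<Rightarrow> L2_bGamma \<Rightarrow> L2_bGamma" is
  "\<lambda>\<phi> f. if \<phi> \<in> Linfty_bGamma then (\<lambda>x. \<phi> x * f x) else (\<lambda>_. 0)"
proof -
  fix \<phi> f g assume *: "L2_rel f g"
  show "L2_rel (if \<phi> \<in> Linfty_bGamma then (\<lambda>x. \<phi> x * f x) else (\<lambda>_. 0))
      (if \<phi> \<in> Linfty_bGamma then (\<lambda>x. \<phi> x * g x) else (\<lambda>_. 0))"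
  proof (cases "\<phi> \<in> Linfty_bGamma")
    case True
    then obtain C where C: "\<phi> \<in> borel_measurable nu" "AE x in nu. cmod (\<phi> x) \<le> C"
      by (auto simp: Linfty_bGamma_def)
    have "AE x in nu. \<phi> x * f x = \<phi> x * g x"
      using * by (auto simp: L2_rel_def elim: eventually_mono)
    then show ?thesis
      using True * square_integrable_mult[OF C] by (simp add: L2_rel_def)
  qed (simp add: L2_rel_def square_integrable_zero)
qed

definition toeplitz :: "(complex \<times> complex \<Rightarrow> complex) \<Rightarrow> H2_G \<Rightarrow> H2_G" where
  "toeplitz \<phi> f = Pr (mult_op \<phi> (of_H2 f))"

text \<open>\<open>s\<close> and \<open>p\<close> are the coordinate functions.\<close>

definition T_s :: "H2_G \<Rightarrow> H2_G" where
  "T_s = toeplitz fst"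

definition T_p :: "H2_G \<Rightarrow> H2_G" where
  "T_p = toeplitz snd"

lemma coordinates_Linfty: "fst \<in> Linfty_bGamma" "snd \<in> Linfty_bGamma"
proof -
  have "cmod (fst x) \<le> 2 \<and> cmod (snd x) \<le> 2" if xG: "x \<in> bGamma" for x
  proof -
    obtain a b where x: "x = symm_map (a, b)" and ab: "cmod a = 1" "cmod b = 1"
      using xG by (auto simp: bGamma_def)
    have "cmod (a + b) \<le> cmod a + cmod b"
      by (rule norm_triangle_ineq)
    then show ?thesis
      using ab by (simp add: x symm_map_def norm_mult)
  qed
  then have "AE x in nu. cmod (fst x) \<le> 2" "AE x in nu. cmod (snd x) \<le> 2"
    by (auto intro!: AE_I2)
  moreover have "fst \<in> borel_measurable nu" "snd \<in> borel_measurable nu"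
    by (auto simp: measurable_cong_sets[OF sets_nu refl] intro!: measurable_restrict_space1
        borel_measurable_continuous_onI continuous_intros)
  ultimately show "fst \<in> Linfty_bGamma" "snd \<in> Linfty_bGamma"
    by (auto simp: Linfty_bGamma_def)
qed

end

theory Submission
  imports Defs
begin

text \<open>
  On \<open>b\<Gamma>\<close> one has \<open>cnj s * p = s\<close> and \<open>cnj p * p = 1\<close>, which gives the relations for \<open>T\<^sub>\<phi>\<close>.
  Conversely, under the second relation \<open>cnj p ^ n * T (p ^ n * f)\<close> is the orthogonal projection of
  the next term of this sequence to \<open>cnj p ^ n * H\<^sup>2\<close>, so that the sequence is bounded with
  orthogonal increments and converges to some \<open>X f\<close>. The operator \<open>X\<close> compresses to \<open>T\<close> and
  commutes with multiplication by \<open>p\<close> and, by the first relation, by \<open>s\<close>. Put \<open>\<phi> = X 1\<close>. Then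
  \<open>\<parallel>\<phi> * a\<parallel> \<le> \<parallel>T\<parallel> * \<parallel>a\<parallel>\<close> for all polynomials \<open>a\<close> in \<open>s\<close>, \<open>p\<close> and \<open>cnj p\<close>. By Stone--Weierstrass these
  are dense in \<open>L\<^sup>2\<close> of every finite Borel measure on \<open>b\<Gamma>\<close>; hence \<open>\<bar>\<phi>\<bar> \<le> \<parallel>T\<parallel>\<close> almost everywhere, and
  \<open>X\<close> is multiplication by \<open>\<phi>\<close>.
\<close>

section \<open>Completeness of \<open>L\<^sup>2\<close> and orthogonal projection\<close>

text \<open>Of the two coordinates only \<open>p\<close> is unimodular on \<open>bGamma\<close>, so
  only its powers act as invertible isometries. The limit operator is therefore built from
  \<open>p\<close> alone, and commutation with \<open>s\<close> is recovered afterwards in weak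
  form, by testing against the spaces \<open>cnj p ^ n * H^2\<close>, whose union is dense. The
  identity \<open>cnj s = s * cnj p\<close> serves twice: it is the pointwise content of the first
  relation, and it makes the algebra generated by \<open>s\<close>, \<open>p\<close> and
  \<open>cnj p\<close> closed under conjugation on \<open>bGamma\<close>, which Stone-Weierstrass
  requires. The limit operator lives on H^2 only, so estimates for Laurent polynomials are first
  multiplied by a power of \<open>p\<close> to enter H^2. Its value \<phi> at 1 is a priori just
  square integrable: multiplication by \<phi> is not yet known to be continuous, and density in
  L^2(\<open>nu\<close>) alone would not carry the estimate over to an indicator function. Hence
  density is proved for arbitrary finite measures, to be available for the weight
  \<open>1 + |\<phi>|^2\<close>. Any positive bound \<open>K\<close> stands in for the norm of
  \<open>T\<close>.\<close>

lemma infdist_attained_imp_orthogonal: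
  fixes S :: "'a::real_inner set"
  assumes S: "subspace S" and h: "h \<in> S" and g: "g \<in> S"
    and min: "\<And>k. k \<in> S \<Longrightarrow> norm (f - h) \<le> norm (f - k)"
  shows "(f - h) \<bullet> g = 0"
proof (cases "g = 0")
  case False
  \<comment> \<open>This \<open>t\<close> minimises the quadratic polynomial \<open>eq\<close> for
    \<open>u = f - h\<close>; the gain over \<open>t = 0\<close> is the square of the inner product
    divided by \<open>g \<bullet> g\<close>.\<close>
  define t where "t = ((f - h) \<bullet> g) / (g \<bullet> g)"
  have gg: "g \<bullet> g > 0"
    using False by simp
  have "h + t *\<^sub>R g \<in> S"
    using S h g by (simp add: subspace_add subspace_scale)
  have eq: "(norm (u - t *\<^sub>R g))\<^sup>2 = (norm u)\<^sup>2 - 2 * t * (u \<bullet> g) + t * t * (g \<bullet> g)" for u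
    unfolding power2_norm_eq_inner
    by (simp add: inner_diff_left inner_diff_right inner_commute[of g u] algebra_simps)
  from min[OF \<open>h + t *\<^sub>R g \<in> S\<close>] have "(norm (f - h))\<^sup>2 \<le> (norm (f - h - t *\<^sub>R g))\<^sup>2"
    by (simp add: diff_diff_eq)
  also have "\<dots> = (norm (f - h))\<^sup>2 - ((f - h) \<bullet> g)\<^sup>2 / (g \<bullet> g)"
    unfolding eq using gg by (simp add: t_def power2_eq_square)
  finally have "((f - h) \<bullet> g)\<^sup>2 / (g \<bullet> g) \<le> 0"
    by simp
  then have "((f - h) \<bullet> g)\<^sup>2 \<le> 0"
    using gg by (simp add: divide_le_0_iff)
  then show ?thesis
    by simp
qed simp

text \<open>A minimising sequence for the distance is Cauchy by the parallelogram law. Only real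
  orthogonality is obtained; the complex version follows in \<open>cinner_Pr\<close>.\<close>

lemma orthogonal_projection_exists:
  fixes S :: "'a::real_inner set"
  assumes S: "subspace S"
    and complete: "\<And>h. (\<And>n. h n \<in> S) \<Longrightarrow> Cauchy h \<Longrightarrow> \<exists>l\<in>S. h \<longlonglongrightarrow> l"
  shows "\<exists>h\<in>S. \<forall>g\<in>S. (f - h) \<bullet> g = 0"
proof -
  define d where "d = infdist f S"
  have ne: "S \<noteq> {}"
    using S subspace_0 by blast
  have d: "d \<le> norm (f - k)" if "k \<in> S" for k
    using infdist_le[OF that, of f] by (simp add: d_def dist_norm)
  have d0: "0 \<le> d"
    by (simp add: d_def infdist_nonneg)
  have "\<exists>h\<in>S. (norm (f - h))\<^sup>2 < d\<^sup>2 + e" if e: "e > 0" for e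
  proof -
    have "d < sqrt (d\<^sup>2 + e)"
      using e d0 by (simp add: real_less_rsqrt)
    then obtain h where h: "h \<in> S" "dist f h < sqrt (d\<^sup>2 + e)"
      unfolding d_def infdist_def using ne by (auto simp: cINF_less_iff)
    then have "(dist f h)\<^sup>2 < (sqrt (d\<^sup>2 + e))\<^sup>2"
      by (intro power_strict_mono) auto
    then show ?thesis
      using h e by (auto simp: dist_norm)
  qed
  from this[of "inverse (Suc n)" for n]
  have "\<forall>n. \<exists>h. h \<in> S \<and> (norm (f - h))\<^sup>2 < d\<^sup>2 + inverse (Suc n)"
    by (simp add: Bex_def)
  then obtain h where h: "h n \<in> S" "(norm (f - h n))\<^sup>2 < d\<^sup>2 + inverse (Suc n)" for n
    by metis
  \<comment> \<open>The midpoint of \<open>h m\<close> and \<open>h n\<close> lies in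
    \<open>S\<close>, so its distance to \<open>f\<close> is at least \<open>d\<close>; this bounds
    the other diagonal of the parallelogram spanned by \<open>f - h m\<close> and
    \<open>f - h n\<close>.\<close>
  have parallelogram: "(norm (h m - h n))\<^sup>2 \<le> 2 * inverse (Suc m) + 2 * inverse (Suc n)" for m n
  proof -
    have "(1/2) *\<^sub>R (h m + h n) \<in> S"
      using S h by (simp add: subspace_add subspace_scale)
    then have "d\<^sup>2 \<le> (norm (f - (1/2) *\<^sub>R (h m + h n)))\<^sup>2"
      using d d0 by (intro power_mono) auto
    moreover have "(norm (h m - h n))\<^sup>2 + 4 * (norm (f - (1/2) *\<^sub>R (h m + h n)))\<^sup>2 =
        2 * (norm (f - h m))\<^sup>2 + 2 * (norm (f - h n))\<^sup>2"
    proof -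
      define a b where "a = f - h m" and "b = f - h n"
      have "(norm (b - a))\<^sup>2 + (norm (a + b))\<^sup>2 = 2 * (norm a)\<^sup>2 + 2 * (norm b)\<^sup>2"
        unfolding power2_norm_eq_inner
        by (simp add: inner_diff_left inner_diff_right inner_add_left inner_add_right)
      moreover have "b - a = h m - h n" "a + b = (f + f) - (h m + h n)"
        by (simp_all add: a_def b_def)
      moreover have "f - (1/2) *\<^sub>R (h m + h n) = (1/2) *\<^sub>R ((f + f) - (h m + h n))"
        by (simp only: scaleR_diff_right scaleR_half_double)
      ultimately show ?thesis
        by (simp add: power_divide) (simp add: a_def b_def)
    qed
    ultimately show ?thesis
      using h(2)[of m] h(2)[of n] by linarith
  qed
  have "Cauchy h"
  proof (rule CauchyI)
    fix e :: real assume e: "e > 0"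
    then obtain N where N: "inverse (Suc N) < e\<^sup>2 / 4"
      using reals_Archimedean[of "e\<^sup>2 / 4"] by auto
    have "norm (h m - h n) < e" if "m \<ge> N" "n \<ge> N" for m n
    proof -
      have "inverse (real (Suc m)) \<le> inverse (real (Suc N))" "inverse (real (Suc n)) \<le> inverse (real (Suc N))"
        using that by (auto intro!: le_imp_inverse_le)
      then have "(norm (h m - h n))\<^sup>2 < e\<^sup>2"
        using parallelogram[of m n] N by linarith
      then show ?thesis
        by (rule power2_less_imp_less) (use e in simp)
    qed
    then show "\<exists>N. \<forall>m\<ge>N. \<forall>n\<ge>N. norm (h m - h n) < e"
      by blast
  qed
  then obtain h0 where h0: "h0 \<in> S" "h \<longlonglongrightarrow> h0"
    using complete h(1) by blast
  have "(norm (f - h0))\<^sup>2 \<le> d\<^sup>2 + 0"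
  proof (rule LIMSEQ_le)
    show "(\<lambda>n. (norm (f - h n))\<^sup>2) \<longlonglongrightarrow> (norm (f - h0))\<^sup>2"
      by (intro tendsto_intros h0)
    show "(\<lambda>n. d\<^sup>2 + inverse (Suc n)) \<longlonglongrightarrow> d\<^sup>2 + 0"
      by (intro tendsto_add tendsto_const LIMSEQ_inverse_real_of_nat)
  qed (use h(2) in \<open>auto intro!: exI[of _ 0] less_imp_le\<close>)
  then have "norm (f - h0) \<le> d"
    unfolding add_0_right by (rule power2_le_imp_le[OF _ d0])
  then have min: "norm (f - h0) \<le> norm (f - k)" if "k \<in> S" for k
    using d[OF that] by linarith
  have "(f - h0) \<bullet> g = 0" if "g \<in> S" for g
    by (rule infdist_attained_imp_orthogonal[OF S h0(1) that min])
  then show ?thesis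
    by (intro bexI[OF _ h0(1)] ballI)
qed

section \<open>Riesz-Fischer for the measure \<open>nu\<close>\<close>

lemma finite_measure_nu: "finite_measure nu"
proof
  interpret t: prob_space torus_measure by (rule prob_space_torus_measure)
  have "integrable torus_measure (\<lambda>z. (cmod (jac z))\<^sup>2)"
  proof (rule t.integrable_const_bound[where B = 4])
    have "(cmod (jac z))\<^sup>2 \<le> 2\<^sup>2" if "z \<in> space torus_measure" for z
      using that norm_triangle_ineq4[of "fst z" "snd z"]
      by (intro power_mono) (auto simp: jac_def)
    then show "AE z in torus_measure. norm ((cmod (jac z))\<^sup>2) \<le> 4"
      by (intro AE_I2) auto
  qed measurable
  then have "integrable nu (\<lambda>x. 1::real)"
    by (subst integrable_nu_iff) auto
  then show "emeasure nu (space nu) \<noteq> \<infinity>"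
    by (simp add: integrable_iff_bounded)
qed

interpretation nu: finite_measure nu
  by (rule finite_measure_nu)

lemma L2_rel_refl [simp]: "L2_rel f f \<longleftrightarrow> square_integrable f"
  by (simp add: L2_rel_def)

lemma L2_cases:
  obtains f where "square_integrable f" "F = abs_L2_bGamma f"
  by (metis L2_rel_refl Quotient_L2_bGamma Quotient_abs_rep Quotient_rep_reflp)

lemma abs_L2_eq_iff:
  "square_integrable f \<Longrightarrow> square_integrable g \<Longrightarrow>
    abs_L2_bGamma f = abs_L2_bGamma g \<longleftrightarrow> (AE x in nu. f x = g x)"
  using Quotient_rel[OF Quotient_L2_bGamma, of f g] by (auto simp: L2_rel_def)

lemma abs_L2_add:
  "square_integrable f \<Longrightarrow> square_integrable g \<Longrightarrow>
    abs_L2_bGamma f + abs_L2_bGamma g = abs_L2_bGamma (\<lambda>x. f x + g x)"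
  by (simp add: plus_L2_bGamma.abs_eq)

lemma abs_L2_diff:
  "square_integrable f \<Longrightarrow> square_integrable g \<Longrightarrow>
    abs_L2_bGamma f - abs_L2_bGamma g = abs_L2_bGamma (\<lambda>x. f x - g x)"
  by (simp add: minus_L2_bGamma.abs_eq)

lemma abs_L2_scaleC:
  "square_integrable f \<Longrightarrow> scaleC_L2 c (abs_L2_bGamma f) = abs_L2_bGamma (\<lambda>x. c * f x)"
  by (simp add: scaleC_L2.abs_eq)

lemma norm_abs_L2:
  "square_integrable f \<Longrightarrow> (norm (abs_L2_bGamma f))\<^sup>2 = (LINT x|nu. (cmod (f x))\<^sup>2) / 2"
  by (simp add: norm_L2_bGamma.abs_eq jac_norm_eq)

lemma cinner_abs_L2:
  "square_integrable f \<Longrightarrow> square_integrable g \<Longrightarrow>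
    cinner_L2 (abs_L2_bGamma f) (abs_L2_bGamma g) = (LINT x|nu. f x * cnj (g x)) / 2"
  by (simp add: cinner_L2.abs_eq jac_norm_eq flip: of_real_power)

lemma square_integrable_bounded:
  assumes "f \<in> borel_measurable nu" "\<And>x. x \<in> bGamma \<Longrightarrow> cmod (f x) \<le> B"
  shows "square_integrable f"
  unfolding square_integrable_def
proof
  show "integrable nu (\<lambda>x. (cmod (f x))\<^sup>2)"
    using assms by (intro nu.integrable_const_bound[where B = "B\<^sup>2"] AE_I2) (auto intro: power_mono)
qed (rule assms)

lemma square_integrable_norm: "square_integrable f \<Longrightarrow> square_integrable (\<lambda>x. of_real (cmod (f x)))"
  by (auto simp: square_integrable_def intro!: borel_measurable_of_real borel_measurable_norm)

lemma square_integrable_imp_integrable: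
  "square_integrable f \<Longrightarrow> integrable nu f"
  using integrable_cinner[of f "\<lambda>_. 1"] square_integrable_bounded[of "\<lambda>_. 1" 1] by simp

text \<open>Cauchy-Schwarz for the modulus of \<open>f\<close> and the constant 1. The factor 2
  undoes the normalisation of the inner product by \<open>jac_norm\<close> squared.\<close>

lemma L1_le_L2:
  assumes f: "square_integrable f"
  shows "(LINT x|nu. cmod (f x)) \<le> 2 * norm (abs_L2_bGamma (\<lambda>_. 1)) * norm (abs_L2_bGamma f)"
proof -
  have 1: "square_integrable (\<lambda>_. 1)"
    by (rule square_integrable_bounded[of _ 1]) auto
  define g where "g = (\<lambda>x. complex_of_real (cmod (f x)))"
  have g: "square_integrable g"
    unfolding g_def by (rule square_integrable_norm[OF f])
  have "abs_L2_bGamma g \<bullet> abs_L2_bGamma (\<lambda>_. 1) \<le> norm (abs_L2_bGamma g) * norm (abs_L2_bGamma (\<lambda>_. 1))"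
    by (rule norm_cauchy_schwarz)
  also have "norm (abs_L2_bGamma g) = norm (abs_L2_bGamma f)"
  proof (rule power2_eq_imp_eq)
    show "(norm (abs_L2_bGamma g))\<^sup>2 = (norm (abs_L2_bGamma f))\<^sup>2"
      unfolding norm_abs_L2[OF f] norm_abs_L2[OF g] by (simp add: g_def)
  qed auto
  also have "abs_L2_bGamma g \<bullet> abs_L2_bGamma (\<lambda>_. 1) = (LINT x|nu. cmod (f x)) / 2"
    unfolding inner_L2_bGamma_def cinner_abs_L2[OF g 1] by (simp add: g_def)
  finally show ?thesis
    by (simp add: algebra_simps)
qed

text \<open>Since \<open>nu\<close> is finite, the sequence is also Cauchy in L^1, which yields an
  almost everywhere convergent subsequence; Fatou's lemma shows that its pointwise limit is the L^2
  limit of the whole sequence.\<close>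

lemma L2_Cauchy_convergent:
  fixes F :: "nat \<Rightarrow> L2_bGamma"
  assumes F: "Cauchy F"
  shows "convergent F"
proof -
  have "\<exists>f. square_integrable f \<and> F n = abs_L2_bGamma f" for n
    by (metis L2_cases)
  then obtain f where f: "\<And>n. square_integrable (f n)" "\<And>n. F n = abs_L2_bGamma (f n)"
    by metis
  have m [measurable]: "f n \<in> borel_measurable nu" for n
    using f(1) by (simp add: square_integrable_def)
  \<comment> \<open>The summand 1 only makes \<open>K\<close> positive, so that \<open>e / K\<close>
    can serve as a tolerance.\<close>
  define K where "K = 2 * norm (abs_L2_bGamma (\<lambda>_. 1)) + 1"
  have K: "K > 0"
    by (simp add: K_def add_nonneg_pos)
  have L1: "(LINT x|nu. norm (f i x - f j x)) \<le> K * norm (F i - F j)" for i j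
  proof -
    have "(LINT x|nu. norm (f i x - f j x)) \<le> (K - 1) * norm (F i - F j)"
      using L1_le_L2[OF square_integrable_diff[OF f(1) f(1)], of i j]
      by (simp add: K_def f abs_L2_diff)
    also have "\<dots> \<le> K * norm (F i - F j)"
      by (intro mult_right_mono) auto
    finally show ?thesis .
  qed
  have "\<exists>N. \<forall>i\<ge>N. \<forall>j\<ge>N. (LINT x|nu. norm (f i x - f j x)) < e" if e: "e > 0" for e
  proof -
    obtain N where N: "\<And>i j. i \<ge> N \<Longrightarrow> j \<ge> N \<Longrightarrow> norm (F i - F j) < e / K"
      using CauchyD[OF F, of "e / K"] e K by auto
    have "(LINT x|nu. norm (f i x - f j x)) < e" if "i \<ge> N" "j \<ge> N" for i j
      using L1[of i j] N[OF that] K by (simp add: field_simps)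
    then show ?thesis
      by blast
  qed
  then obtain r where r: "strict_mono r" "AE x in nu. Cauchy (\<lambda>i. f (r i) x)"
    using cauchy_L1_AE_cauchy_subseq[of nu f] square_integrable_imp_integrable[OF f(1)] by blast
  define g where "g x = lim (\<lambda>i. f (r i) x)" for x
  have g [measurable]: "g \<in> borel_measurable nu"
    unfolding g_def by (intro borel_measurable_lim_metric m)
  have lim: "AE x in nu. (\<lambda>i. f (r i) x) \<longlonglongrightarrow> g x"
    using r(2) by eventually_elim (simp add: g_def Cauchy_convergent_iff convergent_LIMSEQ_iff)
  have sq: "(\<integral>\<^sup>+x. ennreal ((cmod (f i x - f j x))\<^sup>2) \<partial>nu) = ennreal (2 * (norm (F i - F j))\<^sup>2)" for i j
  proof -
    have sqi: "square_integrable (\<lambda>x. f i x - f j x)"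
      by (intro square_integrable_diff f)
    have "(LINT x|nu. (cmod (f i x - f j x))\<^sup>2) = 2 * (norm (F i - F j))\<^sup>2"
      using norm_abs_L2[OF sqi] by (simp add: f abs_L2_diff)
    then show ?thesis
      using sqi by (subst nn_integral_eq_integral) (auto simp: square_integrable_def)
  qed
  \<comment> \<open>Fatou along the subsequence \<open>r\<close>, with \<open>n\<close> fixed.
    Nonnegative integrals are used because \<open>g\<close> is not yet known to be square
    integrable.\<close>
  have close: "(\<integral>\<^sup>+x. ennreal ((cmod (g x - f n x))\<^sup>2) \<partial>nu) \<le> ennreal (2 * e\<^sup>2)"
    if e: "\<And>i. i \<ge> n \<Longrightarrow> norm (F i - F n) \<le> e" for n and e :: real
  proof -
    have "(\<integral>\<^sup>+x. ennreal ((cmod (g x - f n x))\<^sup>2) \<partial>nu) =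
        (\<integral>\<^sup>+x. liminf (\<lambda>i. ennreal ((cmod (f (r i) x - f n x))\<^sup>2)) \<partial>nu)"
    proof (rule nn_integral_cong_AE)
      show "AE x in nu. ennreal ((cmod (g x - f n x))\<^sup>2) = liminf (\<lambda>i. ennreal ((cmod (f (r i) x - f n x))\<^sup>2))"
        using lim
      proof eventually_elim
        case (elim x)
        then have "(\<lambda>i. ennreal ((cmod (f (r i) x - f n x))\<^sup>2)) \<longlonglongrightarrow> ennreal ((cmod (g x - f n x))\<^sup>2)"
          by (intro tendsto_intros)
        then show ?case
          by (intro lim_imp_Liminf[symmetric]) auto
      qed
    qed
    also have "\<dots> \<le> liminf (\<lambda>i. \<integral>\<^sup>+x. ennreal ((cmod (f (r i) x - f n x))\<^sup>2) \<partial>nu)"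
      by (rule nn_integral_liminf) measurable
    also have "\<dots> \<le> ennreal (2 * e\<^sup>2)"
    proof (rule Liminf_le)
      show "\<forall>\<^sub>F i in sequentially. (\<integral>\<^sup>+x. ennreal ((cmod (f (r i) x - f n x))\<^sup>2) \<partial>nu) \<le> ennreal (2 * e\<^sup>2)"
        using eventually_ge_at_top[of n]
      proof eventually_elim
        case (elim i)
        then have "r i \<ge> n"
          using seq_suble[OF r(1), of i] by linarith
        then show ?case
          unfolding sq using e by (intro ennreal_leI mult_left_mono power_mono) auto
      qed
    qed simp
    finally show ?thesis .
  qed
  have g_close: "square_integrable (\<lambda>x. g x - f n x)"
    "norm (abs_L2_bGamma (\<lambda>x. g x - f n x)) \<le> e"
    if e: "\<And>i. i \<ge> n \<Longrightarrow> norm (F i - F n) \<le> e" for n e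
  proof -
    have e0: "e \<ge> 0"
      using e[of n] by simp
    have le: "(\<integral>\<^sup>+x. ennreal ((cmod (g x - f n x))\<^sup>2) \<partial>nu) \<le> ennreal (2 * e\<^sup>2)"
      by (rule close) (rule e)
    have "(\<integral>\<^sup>+x. ennreal ((cmod (g x - f n x))\<^sup>2) \<partial>nu) < \<infinity>"
      unfolding infinity_ennreal_def by (rule order_le_less_trans[OF le ennreal_less_top])
    then have int: "integrable nu (\<lambda>x. (cmod (g x - f n x))\<^sup>2)"
      by (simp add: integrable_iff_bounded)
    then show sq: "square_integrable (\<lambda>x. g x - f n x)"
      by (simp add: square_integrable_def)
    have "ennreal (LINT x|nu. (cmod (g x - f n x))\<^sup>2) \<le> ennreal (2 * e\<^sup>2)"
      using le int by (simp add: nn_integral_eq_integral)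
    then have "(LINT x|nu. (cmod (g x - f n x))\<^sup>2) \<le> 2 * e\<^sup>2"
      by (simp add: ennreal_le_iff)
    then have "(norm (abs_L2_bGamma (\<lambda>x. g x - f n x)))\<^sup>2 \<le> e\<^sup>2"
      unfolding norm_abs_L2[OF sq] by linarith
    then show "norm (abs_L2_bGamma (\<lambda>x. g x - f n x)) \<le> e"
      by (rule power2_le_imp_le[OF _ e0])
  qed
  obtain N where N: "\<And>i j. i \<ge> N \<Longrightarrow> j \<ge> N \<Longrightarrow> norm (F i - F j) < 1"
    using CauchyD[OF F, of 1] by auto
  \<comment> \<open>Square integrability is known only for the differences \<open>g - f N\<close>;
    adding \<open>f N\<close> back transfers it to \<open>g\<close>.\<close>
  have "square_integrable (\<lambda>x. g x - f N x + f N x)"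
    using N by (intro square_integrable_add f g_close[of N 1]) (auto intro: less_imp_le)
  then have g2: "square_integrable g"
    by simp
  have "F \<longlonglongrightarrow> abs_L2_bGamma g"
  proof (rule LIMSEQ_I)
    fix e :: real assume e: "e > 0"
    obtain N where N: "\<And>i j. i \<ge> N \<Longrightarrow> j \<ge> N \<Longrightarrow> norm (F i - F j) < e / 2"
      using CauchyD[OF F, of "e / 2"] e by auto
    have "norm (F n - abs_L2_bGamma g) < e" if n: "n \<ge> N" for n
    proof -
      have "norm (abs_L2_bGamma g - F n) \<le> e / 2"
        using g_close(2)[of n "e / 2"] N n
        by (fastforce simp: f abs_L2_diff g2 intro: less_imp_le)
      then show ?thesis
        using e by (simp add: norm_minus_commute)
    qed
    then show "\<exists>no. \<forall>n\<ge>no. norm (F n - abs_L2_bGamma g) < e"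
      by blast
  qed
  then show ?thesis
    by (rule convergentI)
qed

section \<open>Multiplication operators\<close>

lemma cinner_L2_add_right: "cinner_L2 h (f + g) = cinner_L2 h f + cinner_L2 h g"
  by (subst (1 2 3) cinner_L2_commute) (simp add: cinner_L2_add_left)

lemma cinner_L2_scaleC_right: "cinner_L2 g (scaleC_L2 c f) = cnj c * cinner_L2 g f"
  by (subst (1 2) cinner_L2_commute) (simp add: cinner_L2_scaleC_left)

lemma cinner_L2_uminus_left: "cinner_L2 (- f) g = - cinner_L2 f g"
  by (simp add: uminus_L2_conv cinner_L2_scaleC_left)

lemma cinner_L2_uminus_right: "cinner_L2 g (- f) = - cinner_L2 g f"
  by (simp add: uminus_L2_conv cinner_L2_scaleC_right)

lemma cinner_L2_diff_left: "cinner_L2 (f - g) h = cinner_L2 f h - cinner_L2 g h"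
  unfolding diff_conv_add_uminus cinner_L2_add_left cinner_L2_uminus_left ..

lemma cinner_L2_diff_right: "cinner_L2 h (f - g) = cinner_L2 h f - cinner_L2 h g"
  unfolding diff_conv_add_uminus cinner_L2_add_right cinner_L2_uminus_right ..

lemma cinner_L2_self_eq_0: "cinner_L2 f f = 0 \<longleftrightarrow> f = 0"
  by (simp add: cinner_L2_self)

lemma Re_cinner_L2_le: "Re (cinner_L2 f g) \<le> norm f * norm g"
  using norm_cauchy_schwarz[of f g] by (simp add: inner_L2_bGamma_def)

lemma Linfty_measurable: "\<phi> \<in> Linfty_bGamma \<Longrightarrow> \<phi> \<in> borel_measurable nu"
  by (simp add: Linfty_bGamma_def)

lemma LinftyI:
  "\<phi> \<in> borel_measurable nu \<Longrightarrow> (\<And>x. x \<in> bGamma \<Longrightarrow> cmod (\<phi> x) \<le> B) \<Longrightarrow> \<phi> \<in> Linfty_bGamma"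
  by (auto simp: Linfty_bGamma_def intro!: exI[of _ B] AE_I2)

lemma Linfty_const: "(\<lambda>_. c) \<in> Linfty_bGamma"
  by (rule LinftyI[where B = "cmod c"]) auto

lemma Linfty_add:
  assumes "\<phi> \<in> Linfty_bGamma" "\<psi> \<in> Linfty_bGamma"
  shows "(\<lambda>x. \<phi> x + \<psi> x) \<in> Linfty_bGamma"
proof -
  obtain B C where B: "AE x in nu. cmod (\<phi> x) \<le> B" and C: "AE x in nu. cmod (\<psi> x) \<le> C"
    using assms by (auto simp: Linfty_bGamma_def)
  have "AE x in nu. cmod (\<phi> x + \<psi> x) \<le> B + C"
    using B C by eventually_elim (rule norm_triangle_mono)
  then show ?thesis
    using assms by (auto simp: Linfty_bGamma_def intro!: borel_measurable_add)
qed

lemma Linfty_mult: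
  assumes "\<phi> \<in> Linfty_bGamma" "\<psi> \<in> Linfty_bGamma"
  shows "(\<lambda>x. \<phi> x * \<psi> x) \<in> Linfty_bGamma"
proof -
  obtain B C where B: "AE x in nu. cmod (\<phi> x) \<le> B" and C: "AE x in nu. cmod (\<psi> x) \<le> C"
    using assms by (auto simp: Linfty_bGamma_def)
  have "AE x in nu. cmod (\<phi> x * \<psi> x) \<le> \<bar>B\<bar> * \<bar>C\<bar>"
    using B C by eventually_elim (auto simp: norm_mult intro!: mult_mono)
  then show ?thesis
    using assms by (auto simp: Linfty_bGamma_def intro!: borel_measurable_times)
qed

lemma Linfty_cnj: "\<phi> \<in> Linfty_bGamma \<Longrightarrow> (\<lambda>x. cnj (\<phi> x)) \<in> Linfty_bGamma"
  by (auto simp: Linfty_bGamma_def intro!: borel_measurable_cnj)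

lemma Linfty_power: "\<phi> \<in> Linfty_bGamma \<Longrightarrow> (\<lambda>x. \<phi> x ^ n) \<in> Linfty_bGamma"
  by (induction n) (simp_all add: Linfty_const Linfty_mult)

lemma Linfty_square_integrable_mult:
  "\<phi> \<in> Linfty_bGamma \<Longrightarrow> square_integrable f \<Longrightarrow> square_integrable (\<lambda>x. \<phi> x * f x)"
  by (auto simp: Linfty_bGamma_def intro: square_integrable_mult)

lemma Linfty_square_integrable: "\<phi> \<in> Linfty_bGamma \<Longrightarrow> square_integrable \<phi>"
  using Linfty_square_integrable_mult[of \<phi> "\<lambda>_. 1"] square_integrable_bounded[of "\<lambda>_. 1" 1] by simp

lemma mult_op_abs:
  "\<phi> \<in> Linfty_bGamma \<Longrightarrow> square_integrable f \<Longrightarrow>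
    mult_op \<phi> (abs_L2_bGamma f) = abs_L2_bGamma (\<lambda>x. \<phi> x * f x)"
  by (simp add: mult_op.abs_eq)

lemma mult_op_cong_AE:
  assumes "\<phi> \<in> Linfty_bGamma" "\<psi> \<in> Linfty_bGamma" "AE x in nu. \<phi> x = \<psi> x"
  shows "mult_op \<phi> F = mult_op \<psi> F"
proof -
  obtain f where f: "square_integrable f" "F = abs_L2_bGamma f"
    by (rule L2_cases)
  have "AE x in nu. \<phi> x * f x = \<psi> x * f x"
    using assms(3) by eventually_elim simp
  then show ?thesis
    using assms f by (simp add: mult_op_abs abs_L2_eq_iff Linfty_square_integrable_mult)
qed

lemma mult_op_cong:
  assumes "\<phi> \<in> Linfty_bGamma" "\<psi> \<in> Linfty_bGamma" "\<And>x. x \<in> bGamma \<Longrightarrow> \<phi> x = \<psi> x"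
  shows "mult_op \<phi> F = mult_op \<psi> F"
  using assms by (intro mult_op_cong_AE AE_I2) auto

lemma mult_op_mult:
  assumes "\<phi> \<in> Linfty_bGamma" "\<psi> \<in> Linfty_bGamma"
  shows "mult_op \<phi> (mult_op \<psi> F) = mult_op (\<lambda>x. \<phi> x * \<psi> x) F"
  using assms
  by (cases F rule: L2_cases)
    (simp add: mult_op_abs Linfty_square_integrable_mult Linfty_mult mult.assoc)

lemma mult_op_commute:
  assumes "\<phi> \<in> Linfty_bGamma" "\<psi> \<in> Linfty_bGamma"
  shows "mult_op \<phi> (mult_op \<psi> F) = mult_op \<psi> (mult_op \<phi> F)"
  using assms by (simp add: mult_op_mult mult.commute)

lemma mult_op_plus:
  assumes "\<phi> \<in> Linfty_bGamma" "\<psi> \<in> Linfty_bGamma"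
  shows "mult_op (\<lambda>x. \<phi> x + \<psi> x) F = mult_op \<phi> F + mult_op \<psi> F"
  using assms
  by (cases F rule: L2_cases)
    (simp add: mult_op_abs Linfty_square_integrable_mult Linfty_add abs_L2_add distrib_right)

lemma mult_op_const: "mult_op (\<lambda>_. c) F = scaleC_L2 c F"
  by (cases F rule: L2_cases) (simp add: mult_op_abs Linfty_const abs_L2_scaleC)

lemma scaleC_L2_one: "scaleC_L2 1 F = F"
  by (cases F rule: L2_cases) (simp add: abs_L2_scaleC)

lemma mult_op_one: "mult_op (\<lambda>_. 1) F = F"
  by (simp add: mult_op_const scaleC_L2_one)

lemma mult_op_add:
  "\<phi> \<in> Linfty_bGamma \<Longrightarrow> mult_op \<phi> (F + G) = mult_op \<phi> F + mult_op \<phi> G"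
  by (cases F rule: L2_cases; cases G rule: L2_cases)
    (simp add: mult_op_abs abs_L2_add square_integrable_add Linfty_square_integrable_mult distrib_left)

lemma mult_op_scaleC:
  "\<phi> \<in> Linfty_bGamma \<Longrightarrow> mult_op \<phi> (scaleC_L2 c F) = scaleC_L2 c (mult_op \<phi> F)"
  by (simp add: mult_op_mult Linfty_const mult.commute flip: mult_op_const)

lemma mult_op_diff:
  "\<phi> \<in> Linfty_bGamma \<Longrightarrow> mult_op \<phi> (F - G) = mult_op \<phi> F - mult_op \<phi> G"
  unfolding diff_conv_add_uminus uminus_L2_conv by (simp add: mult_op_add mult_op_scaleC)

lemma cinner_mult_op:
  assumes "\<phi> \<in> Linfty_bGamma"
  shows "cinner_L2 (mult_op \<phi> F) G = cinner_L2 F (mult_op (\<lambda>x. cnj (\<phi> x)) G)"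
  using assms
  by (cases F rule: L2_cases; cases G rule: L2_cases)
    (simp add: mult_op_abs cinner_abs_L2 Linfty_square_integrable_mult Linfty_cnj, simp add: mult_ac)

lemma norm_mult_op_le:
  assumes \<phi>: "\<phi> \<in> Linfty_bGamma" and C: "AE x in nu. cmod (\<phi> x) \<le> C" "0 \<le> C"
  shows "norm (mult_op \<phi> F) \<le> C * norm F"
proof -
  obtain f where f: "square_integrable f" "F = abs_L2_bGamma f"
    by (rule L2_cases)
  have s: "square_integrable (\<lambda>x. \<phi> x * f x)"
    by (rule Linfty_square_integrable_mult[OF \<phi> f(1)])
  have "(LINT x|nu. (cmod (\<phi> x * f x))\<^sup>2) \<le> (LINT x|nu. C\<^sup>2 * (cmod (f x))\<^sup>2)"
  proof (rule integral_mono_AE)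
    show "AE x in nu. (cmod (\<phi> x * f x))\<^sup>2 \<le> C\<^sup>2 * (cmod (f x))\<^sup>2"
      using C(1)
      by eventually_elim (auto simp: norm_mult power_mult_distrib intro!: mult_right_mono power_mono)
  qed (use s f in \<open>auto simp: square_integrable_def\<close>)
  then have "(norm (mult_op \<phi> F))\<^sup>2 \<le> C\<^sup>2 * (norm F)\<^sup>2"
    by (simp add: f(2) mult_op_abs[OF \<phi> f(1)] norm_abs_L2[OF f(1)] norm_abs_L2[OF s])
  also have "\<dots> = (C * norm F)\<^sup>2"
    by (simp add: power_mult_distrib)
  finally show ?thesis
    by (rule power2_le_imp_le) (use C in simp)
qed

text \<open>Multiplication by \<phi> and by its conjugate are both contractions, and the second
  inverts the first.\<close>

lemma norm_mult_op_unimodular: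
  assumes \<phi>: "\<phi> \<in> Linfty_bGamma" and one: "\<And>x. x \<in> bGamma \<Longrightarrow> cmod (\<phi> x) = 1"
  shows "norm (mult_op \<phi> F) = norm F"
proof -
  have ae: "AE x in nu. cmod (\<phi> x) \<le> 1"
    using one by (intro AE_I2) simp
  have "(\<lambda>x. cnj (\<phi> x) * \<phi> x) \<in> Linfty_bGamma"
    by (intro Linfty_mult Linfty_cnj \<phi>)
  then have "mult_op (\<lambda>x. cnj (\<phi> x) * \<phi> x) F = F"
    using one
    by (subst mult_op_one[of F, symmetric], intro mult_op_cong Linfty_const)
      (auto simp: mult.commute[of "cnj _"] simp flip: complex_norm_square)
  then have "norm F \<le> norm (mult_op \<phi> F)"
    using norm_mult_op_le[OF Linfty_cnj[OF \<phi>], of 1 "mult_op \<phi> F"] ae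
    by (simp add: mult_op_mult Linfty_cnj \<phi>)
  moreover have "norm (mult_op \<phi> F) \<le> norm F"
    using norm_mult_op_le[OF \<phi>, of 1 F] ae by simp
  ultimately show ?thesis
    by simp
qed

lemma norm_snd_bGamma: "x \<in> bGamma \<Longrightarrow> cmod (snd x) = 1"
  by (auto simp: bGamma_def symm_map_def norm_mult)

text \<open>On the torus \<open>cnj z = 1 / z\<close> in each variable, so \<open>cnj (z\<^sub>1 + z\<^sub>2) * (z\<^sub>1 * z\<^sub>2) = z\<^sub>1 + z\<^sub>2\<close>.\<close>

lemma cnj_fst_mult_snd_bGamma:
  assumes "x \<in> bGamma"
  shows "cnj (fst x) * snd x = fst x"
proof -
  obtain a b where x: "x = (a + b, a * b)" "cmod a = 1" "cmod b = 1"
    using assms by (auto simp: bGamma_def symm_map_def)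
  then have "cnj a * a = 1" "cnj b * b = 1"
    by (simp_all add: mult.commute[of "cnj _"] flip: complex_norm_square)
  then show ?thesis
    unfolding x by (simp add: distrib_right mult.assoc[symmetric])
qed

lemma cnj_snd_mult_snd_bGamma: "x \<in> bGamma \<Longrightarrow> cnj (snd x) * snd x = 1"
  using norm_snd_bGamma[of x] by (simp add: mult.commute[of "cnj _"] flip: complex_norm_square)

section \<open>Fourier coefficients and the Hardy space\<close>

lemma arc_integral_power:
  assumes "n > 0"
  shows "(LINT w|arc_measure. w ^ n) = 0"
proof -
  have dens: "indicator {0..2*pi} t / emeasure lborel {0..2*pi} =
      ennreal (indicator {0..2*pi} t / (2*pi))" for t :: real
    by (auto simp: indicator_def divide_ennreal simp flip: ennreal_1)
  have c: "(\<lambda>t. cis (real n * t)) \<in> borel_measurable borel"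
    by (intro borel_measurable_continuous_onI continuous_intros)
  have "(LINT w|arc_measure. w ^ n) = (LINT t|uniform_measure lborel {0..2 * pi}. cis t ^ n)"
    unfolding arc_measure_def
    by (rule integral_distr) (auto intro!: measurable_restrict_space1 borel_measurable_power)
  also have "\<dots> = (LINT t|uniform_measure lborel {0..2 * pi}. cis (real n * t))"
    by (simp only: Complex.DeMoivre)
  also have "\<dots> = (LINT t|lborel. (indicator {0..2*pi} t / (2 * pi)) *\<^sub>R cis (real n * t))"
    unfolding uniform_measure_def dens
    by (rule integral_density) (use c in auto)
  also have "\<dots> = (LINT t|lborel. (1 / (2 * pi)) *\<^sub>R (indicator {0..2*pi} t *\<^sub>R cis (real n * t)))"
    by (intro Bochner_Integration.integral_cong) (auto simp: indicator_def)
  also have "\<dots> = (1 / (2 * pi)) *\<^sub>R (LINT t|lborel. indicator {0..2*pi} t *\<^sub>R cis (real n * t))"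
    by (rule integral_scaleR_right)
  \<comment> \<open>\<open>- \<i> / n * cis (n * t)\<close> is an antiderivative; it takes the same
    value at both ends because \<open>n\<close> is an integer.\<close>
  also have "(LINT t|lborel. indicator {0..2*pi} t *\<^sub>R cis (real n * t)) =
      - \<i> / of_nat n * cis (real n * (2*pi)) - (- \<i> / of_nat n * cis (real n * 0))"
  proof (rule integral_FTC_Icc)
    fix t :: real
    have "((\<lambda>t. - \<i> / of_nat n * cis (real n * t)) has_vector_derivative
        - \<i> / of_nat n * (\<i> * of_nat n * cis (real n * t))) (at t within {0..2*pi})"
      unfolding cis_conv_exp
      by (auto intro!: derivative_eq_intros has_vector_derivative_real_field simp: mult_ac)
    then show "((\<lambda>t. - \<i> / of_nat n * cis (real n * t)) has_vector_derivative cis (real n * t))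
        (at t within {0..2*pi})"
      using assms by simp
  qed (auto intro!: continuous_intros)
  also have "cis (real n * (2 * pi)) = 1"
    using cis_multiple_2pi[of "real n"] by (simp add: mult_ac)
  finally show ?thesis by simp
qed

lemma circle_measurable_times:
  assumes f: "f \<in> borel_measurable borel" and g: "g \<in> borel_measurable borel"
  shows "(\<lambda>z. f (fst z) * g (snd z) :: complex) \<in> borel_measurable torus_measure"
  by (intro borel_measurable_times measurable_compose[OF fst_torus_measurable f]
      measurable_compose[OF snd_torus_measurable g])

lemma torus_integral_times:
  fixes f g :: "complex \<Rightarrow> complex"
  assumes f: "f \<in> borel_measurable borel" and g: "g \<in> borel_measurable borel"
    and B: "\<And>w. cmod w = 1 \<Longrightarrow> cmod (f w) \<le> B" and C: "\<And>w. cmod w = 1 \<Longrightarrow> cmod (g w) \<le> C"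
  shows "integrable torus_measure (\<lambda>z. f (fst z) * g (snd z))"
    and "(LINT z|torus_measure. f (fst z) * g (snd z)) = (LINT w|arc_measure. f w) * (LINT w|arc_measure. g w)"
proof -
  interpret t: prob_space torus_measure by (rule prob_space_torus_measure)
  have B0: "B \<ge> 0"
    using order_trans[OF norm_ge_zero B[of 1]] by simp
  show int: "integrable torus_measure (\<lambda>z. f (fst z) * g (snd z))"
    by (rule t.integrable_const_bound[where B = "B * C"])
      (auto intro!: AE_I2 circle_measurable_times f g mult_mono B C B0 simp: norm_mult)
  have "(LINT z|torus_measure. f (fst z) * g (snd z)) =
      (LINT a|arc_measure. LINT b|arc_measure. f a * g b)"
    using torus.integral_fst'[OF int[unfolded torus_measure_def]]
    by (simp add: torus_measure_def)
  then show "(LINT z|torus_measure. f (fst z) * g (snd z)) = (LINT w|arc_measure. f w) * (LINT w|arc_measure. g w)"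
    by simp
qed

lemma measurable_powi: "(\<lambda>w::complex. w powi k) \<in> borel_measurable borel"
  unfolding power_int_def by (auto intro!: borel_measurable_power)

text \<open>On the circle inversion is conjugation, so the integrand is a positive power of
  \<open>w\<close>, whose mean is 0.\<close>

lemma arc_integral_times_powi_neg:
  assumes "i < 0"
  shows "(LINT w|arc_measure. w ^ n * cnj (w powi i)) = 0"
proof -
  have "(LINT w|arc_measure. w ^ n * cnj (w powi i)) = (LINT w|arc_measure. w ^ (n + nat (- i)))"
  proof (rule Bochner_Integration.integral_cong[OF refl])
    fix w assume "w \<in> space arc_measure"
    then have "w * cnj w = 1"
      by (simp flip: complex_norm_square)
    then have "inverse w = cnj w"
      by (rule inverse_unique)
    then have "w powi i = cnj w ^ nat (- i)"
      using assms by (simp add: power_int_def)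
    then show "w ^ n * cnj (w powi i) = w ^ (n + nat (- i))"
      by (simp add: power_add)
  qed
  then show ?thesis
    using assms by (simp add: arc_integral_power)
qed

lemma fourier_U_abs:
  "square_integrable f \<Longrightarrow> fourier_U (abs_L2_bGamma f) = fourier_coeff (unitary_U f)"
  by (simp add: fourier_U.abs_eq)

text \<open>This puts the constant 1 into H^2. Its image under \<open>U\<close> is a multiple of
  \<open>z1 - z2\<close>; after Fubini each of the two monomials contributes a product in which the
  factor with the negative index vanishes.\<close>

lemma fourier_U_one:
  assumes "i < 0 \<or> j < 0"
  shows "fourier_U (abs_L2_bGamma (\<lambda>_. 1)) i j = 0"
proof -
  have 1: "square_integrable (\<lambda>_. 1)"
    by (rule square_integrable_bounded[of _ 1]) auto
  define p where "p n k w = w ^ n * cnj (w powi k)" for n k and w :: complex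
  have m: "p n k \<in> borel_measurable borel" for n k
    unfolding p_def by (intro borel_measurable_times borel_measurable_cnj measurable_powi borel_measurable_power) auto
  have b: "cmod w = 1 \<Longrightarrow> cmod (p n k w) \<le> 1" for w n k
    by (simp add: p_def norm_mult norm_power norm_power_int)
  have p0: "(LINT w|arc_measure. p n k w) = 0" if "k < 0" for n k
    unfolding p_def using that by (rule arc_integral_times_powi_neg)
  note I = torus_integral_times[OF m m b b]
  have "fourier_U (abs_L2_bGamma (\<lambda>_. 1)) i j =
      (LINT z|torus_measure. (1 / of_real jac_norm) * (p 1 i (fst z) * p 0 j (snd z) - p 0 i (fst z) * p 1 j (snd z)))"
    unfolding fourier_U_abs[OF 1] fourier_coeff_def
    by (intro Bochner_Integration.integral_cong[OF refl])
      (simp add: unitary_U_def jac_def p_def algebra_simps)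
  also have "\<dots> = 0"
    using assms by (auto simp: I p0 simp del: complex_cnj_mult)
  finally show ?thesis .
qed

lemma circle_powi_shift:
  assumes "cmod w = 1"
  shows "w * cnj (w powi k) = cnj (w powi (k - 1))"
proof -
  have w: "w \<noteq> 0" "w * cnj w = 1"
    using assms by (auto simp flip: complex_norm_square)
  have "w powi k = w powi (k - 1) * w"
    using power_int_minus_mult[of w k] w(1) by simp
  then have "w * cnj (w powi k) = (w * cnj w) * cnj (w powi (k - 1))"
    by (simp only: complex_cnj_mult mult.assoc mult.commute mult.left_commute)
  then show ?thesis
    unfolding w(2) by simp
qed

lemma fourier_U_mult_snd: "fourier_U (mult_op snd F) i j = fourier_U F (i - 1) (j - 1)"
proof -
  obtain f where f: "square_integrable f" "F = abs_L2_bGamma f"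
    by (rule L2_cases)
  show ?thesis
    unfolding f(2) mult_op_abs[OF coordinates_Linfty(2) f(1)] fourier_U_abs[OF f(1)]
      fourier_U_abs[OF Linfty_square_integrable_mult[OF coordinates_Linfty(2) f(1)]] fourier_coeff_def
  proof (rule Bochner_Integration.integral_cong[OF refl])
    fix z assume z: "z \<in> space torus_measure"
    have "unitary_U (\<lambda>x. snd x * f x) z * cnj (fst z powi i * snd z powi j) =
        unitary_U f z * ((fst z * cnj (fst z powi i)) * (snd z * cnj (snd z powi j)))"
      by (simp add: unitary_U_def symm_map_def)
    also have "\<dots> = unitary_U f z * cnj (fst z powi (i - 1) * snd z powi (j - 1))"
      using z by (subst (1 2) circle_powi_shift) auto
    finally show "unitary_U (\<lambda>x. snd x * f x) z * cnj (fst z powi i * snd z powi j) =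
        unitary_U f z * cnj (fst z powi (i - 1) * snd z powi (j - 1))" .
  qed
qed

text \<open>Since \<open>s\<close> pulls back to \<open>z1 + z2\<close>, each summand shifts one of
  the two indices. A negative index stays negative under these shifts, whence H^2 is
  invariant.\<close>

lemma fourier_U_mult_fst: "fourier_U (mult_op fst F) i j = fourier_U F (i - 1) j + fourier_U F i (j - 1)"
proof -
  obtain f where f: "square_integrable f" "F = abs_L2_bGamma f"
    by (rule L2_cases)
  have "fourier_U (mult_op fst F) i j = (LINT z|torus_measure.
      unitary_U f z * cnj (fst z powi (i - 1) * snd z powi j) +
      unitary_U f z * cnj (fst z powi i * snd z powi (j - 1)))"
    unfolding f(2) mult_op_abs[OF coordinates_Linfty(1) f(1)]
      fourier_U_abs[OF Linfty_square_integrable_mult[OF coordinates_Linfty(1) f(1)]] fourier_coeff_def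
  proof (rule Bochner_Integration.integral_cong[OF refl])
    fix z assume z: "z \<in> space torus_measure"
    have "unitary_U (\<lambda>x. fst x * f x) z * cnj (fst z powi i * snd z powi j) =
        unitary_U f z * ((fst z * cnj (fst z powi i)) * cnj (snd z powi j)) +
        unitary_U f z * (cnj (fst z powi i) * (snd z * cnj (snd z powi j)))"
      by (simp add: unitary_U_def symm_map_def algebra_simps)
    also have "\<dots> = unitary_U f z * cnj (fst z powi (i - 1) * snd z powi j) +
        unitary_U f z * cnj (fst z powi i * snd z powi (j - 1))"
      using z by (subst (1 2) circle_powi_shift) auto
    finally show "unitary_U (\<lambda>x. fst x * f x) z * cnj (fst z powi i * snd z powi j) =
        unitary_U f z * cnj (fst z powi (i - 1) * snd z powi j) +
        unitary_U f z * cnj (fst z powi i * snd z powi (j - 1))" .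
  qed
  also have "\<dots> = fourier_U F (i - 1) j + fourier_U F i (j - 1)"
    unfolding f(2) fourier_U_abs[OF f(1)] fourier_coeff_def
    by (intro Bochner_Integration.integral_add integrable_fourier f)
  finally show ?thesis .
qed

text \<open>Continuity of the coefficients, from which H^2 is closed. Monomials have modulus 1,
  \<open>U\<close> preserves the norm, and on a probability space the L^1 norm is at most the L^2
  norm.\<close>

lemma norm_fourier_U_le: "cmod (fourier_U F i j) \<le> norm F"
proof -
  interpret t: prob_space torus_measure by (rule prob_space_torus_measure)
  obtain f where f: "square_integrable f" "F = abs_L2_bGamma f"
    by (rule L2_cases)
  define u where "u z = cmod (unitary_U f z)" for z
  have u_eq: "(u z)\<^sup>2 = (1 / 2) * ((cmod (jac z))\<^sup>2 * (cmod (f (symm_map z)))\<^sup>2)" for z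
    by (simp add: u_def unitary_U_def norm_mult norm_divide power_mult_distrib power_divide jac_norm_eq)
  have [measurable]: "f \<in> borel_measurable nu" "u \<in> borel_measurable torus_measure"
    using f(1) unitary_U_measurable[of f] by (auto simp: u_def[abs_def] square_integrable_def)
  have f': "(\<lambda>x. (cmod (f x))\<^sup>2) \<in> borel_measurable (restrict_space borel bGamma)"
    using f(1) by (auto simp: square_integrable_def simp flip: measurable_cong_sets[OF sets_nu refl])
  have u2: "integrable torus_measure (\<lambda>z. (u z)\<^sup>2)"
    unfolding u_eq using f(1)
    by (intro integrable_mult_right, subst integrable_nu_iff[symmetric]) (auto simp: square_integrable_def)
  have u1: "integrable torus_measure u"
    by (rule t.square_integrable_imp_integrable[OF _ u2]) measurable
  have "(LINT x|nu. (cmod (f x))\<^sup>2) =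
      (LINT z|density torus_measure (\<lambda>z. ennreal ((cmod (jac z))\<^sup>2)). (cmod (f (symm_map z)))\<^sup>2)"
    unfolding nu_def by (rule integral_distr[OF _ f']) simp
  also have "\<dots> = (LINT z|torus_measure. (cmod (jac z))\<^sup>2 *\<^sub>R (cmod (f (symm_map z)))\<^sup>2)"
    by (rule integral_density) (auto intro!: measurable_compose[OF symm_map_measurable f'])
  finally have "(LINT z|torus_measure. (u z)\<^sup>2) = (LINT x|nu. (cmod (f x))\<^sup>2) / 2"
    by (simp add: u_eq)
  then have norm_u: "(LINT z|torus_measure. (u z)\<^sup>2) = (norm F)\<^sup>2"
    by (simp add: f norm_abs_L2)
  have "cmod (fourier_U F i j) \<le>
      (LINT z|torus_measure. cmod (unitary_U f z * cnj ((fst z powi i) * (snd z powi j))))"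
    unfolding f(2) fourier_U_abs[OF f(1)] fourier_coeff_def by (rule integral_norm_bound)
  also have "\<dots> = (LINT z|torus_measure. u z)"
    by (intro Bochner_Integration.integral_cong) (auto simp: u_def norm_mult norm_power_int)
  finally have "cmod (fourier_U F i j) \<le> (LINT z|torus_measure. u z)" .
  moreover have "(LINT z|torus_measure. u z)\<^sup>2 \<le> (norm F)\<^sup>2"
    \<comment> \<open>Nonnegativity of the variance of \<open>u\<close> says that the squared mean
      is at most the mean square.\<close>
    using t.variance_eq[OF u1 u2] t.variance_positive[of u] by (simp add: norm_u)
  then have "(LINT z|torus_measure. u z) \<le> norm F"
    by (rule power2_le_imp_le) auto
  ultimately show ?thesis
    by linarith
qed

section \<open>The Hardy space as a closed subspace, its projection, and adjoints of Toeplitz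
  operators\<close>

lemma H2_iff: "(\<exists>h. F = of_H2 h) \<longleftrightarrow> (\<forall>i j. i < 0 \<or> j < 0 \<longrightarrow> fourier_U F i j = 0)"
proof
  assume "\<exists>h. F = of_H2 h"
  then show "\<forall>i j. i < 0 \<or> j < 0 \<longrightarrow> fourier_U F i j = 0"
    using of_H2 by auto
next
  assume "\<forall>i j. i < 0 \<or> j < 0 \<longrightarrow> fourier_U F i j = 0"
  then have "of_H2 (Abs_H2 F) = F"
    by (intro Abs_H2_inverse CollectI)
  then show "\<exists>h. F = of_H2 h"
    by (intro exI) (rule sym)
qed

lemma fourier_U_of_H2: "i < 0 \<or> j < 0 \<Longrightarrow> fourier_U (of_H2 h) i j = 0"
  using H2_iff by blast

lemma subspace_H2: "subspace (range of_H2)"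
proof (rule subspaceI)
  show "0 \<in> range of_H2"
    by (auto simp flip: zero_H2_G.rep_eq)
  show "x + y \<in> range of_H2" if "x \<in> range of_H2" "y \<in> range of_H2" for x y
    using that by (auto simp flip: plus_H2_G.rep_eq)
  show "c *\<^sub>R x \<in> range of_H2" if "x \<in> range of_H2" for c x
    using that by (auto simp flip: scaleR_H2_G.rep_eq)
qed

lemma fourier_U_diff: "fourier_U (f - g) i j = fourier_U f i j - fourier_U g i j"
  unfolding diff_conv_add_uminus uminus_L2_conv fourier_U_add fourier_U_scaleC by simp

lemma H2_closed:
  assumes h: "\<And>n. h n \<in> range of_H2" and l: "h \<longlonglongrightarrow> l"
  shows "l \<in> range of_H2"
proof -
  have "fourier_U l i j = 0" if "i < 0 \<or> j < 0" for i j
  proof -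
    have lim: "(\<lambda>n. norm (l - h n)) \<longlonglongrightarrow> norm (l - l)"
      by (intro tendsto_intros l)
    have "cmod (fourier_U l i j) \<le> norm (l - h n)" for n
    proof -
      have "fourier_U (h n) i j = 0"
        using h[of n] fourier_U_of_H2[OF that] by auto
      then show ?thesis
        using norm_fourier_U_le[of "l - h n" i j] by (simp add: fourier_U_diff)
    qed
    then have "cmod (fourier_U l i j) \<le> norm (l - l)"
      by (intro LIMSEQ_le_const[OF lim]) auto
    then show ?thesis
      by simp
  qed
  then show ?thesis
    using H2_iff[of l] by auto
qed

lemma cinner_H2_eqI:
  assumes "\<And>g. cinner_H2 f g = cinner_H2 h g"
  shows "f = h"
proof -
  have "cinner_L2 (of_H2 f - of_H2 h) (of_H2 (f - h)) = 0"
    using assms[of "f - h"] by (simp add: cinner_L2_diff_left cinner_H2.rep_eq)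
  then have "of_H2 f - of_H2 h = 0"
    by (simp add: cinner_L2_self_eq_0 minus_H2_G.rep_eq)
  then show ?thesis
    by (simp add: of_H2_inject)
qed

text \<open>\<open>Pr\<close> is a definite description, so both existence and uniqueness must be
  shown before its characterisation can be used.\<close>

lemma cinner_Pr: "cinner_H2 (Pr F) g = cinner_L2 F (of_H2 g)"
proof -
  have "\<exists>h\<in>range of_H2. \<forall>g\<in>range of_H2. (F - h) \<bullet> g = 0"
  proof (rule orthogonal_projection_exists[OF subspace_H2])
    fix h assume h: "\<And>n. h n \<in> range of_H2" "Cauchy h"
    then obtain l where "h \<longlonglongrightarrow> l"
      using L2_Cauchy_convergent by (auto simp: convergent_def)
    then show "\<exists>l\<in>range of_H2. h \<longlonglongrightarrow> l"
      using H2_closed[OF h(1)] by (intro bexI)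
  qed
  then obtain h where h: "\<And>g. (F - of_H2 h) \<bullet> of_H2 g = 0"
    by auto
  \<comment> \<open>Real orthogonality to \<open>g\<close> kills the real part; orthogonality to
    \<open>\<i> * g\<close> kills the imaginary part.\<close>
  have "cinner_L2 (F - of_H2 h) (of_H2 g) = 0" for g
    using h[of g] h[of "scaleC_H2 \<i> g"]
    by (simp add: inner_L2_bGamma_def scaleC_H2.rep_eq cinner_L2_scaleC_right complex_eq_iff)
  moreover have "h' = h''" if "\<forall>g. cinner_L2 (F - of_H2 h') (of_H2 g) = 0"
    "\<forall>g. cinner_L2 (F - of_H2 h'') (of_H2 g) = 0" for h' h''
    using that by (intro cinner_H2_eqI) (simp add: cinner_L2_diff_left cinner_H2.rep_eq)
  ultimately have "\<exists>!h. \<forall>g. cinner_L2 (F - of_H2 h) (of_H2 g) = 0"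
    by blast
  from theI'[OF this] show ?thesis
    unfolding Pr_def[symmetric] by (simp add: cinner_L2_diff_left cinner_H2.rep_eq)
qed

lemma Pr_of_H2: "Pr (of_H2 h) = h"
  by (rule cinner_H2_eqI, subst cinner_Pr) (simp add: cinner_H2.rep_eq)

lemma cinner_toeplitz: "cinner_H2 (toeplitz \<phi> f) g = cinner_L2 (mult_op \<phi> (of_H2 f)) (of_H2 g)"
  by (simp add: toeplitz_def cinner_Pr)

lemma cinner_H2_commute: "cinner_H2 f g = cnj (cinner_H2 g f)"
  unfolding cinner_H2.rep_eq by (rule cinner_L2_commute)

text \<open>\<open>adjoint_H2\<close> is a definite description too: the conjugate symbol supplies a
  candidate, and any other candidate agrees with it because inner products separate H^2.\<close>

lemma adjoint_toeplitz:
  assumes "\<phi> \<in> Linfty_bGamma"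
  shows "adjoint_H2 (toeplitz \<phi>) = toeplitz (\<lambda>x. cnj (\<phi> x))"
  unfolding adjoint_H2_def
proof (rule the_equality)
  show *: "\<forall>f g. cinner_H2 (toeplitz \<phi> f) g = cinner_H2 f (toeplitz (\<lambda>x. cnj (\<phi> x)) g)"
  proof (intro allI)
    fix f g
    have "cinner_H2 f (toeplitz (\<lambda>x. cnj (\<phi> x)) g) = cnj (cinner_L2 (mult_op (\<lambda>x. cnj (\<phi> x)) (of_H2 g)) (of_H2 f))"
      by (subst cinner_H2_commute) (simp add: cinner_toeplitz)
    also have "\<dots> = cinner_L2 (of_H2 f) (mult_op (\<lambda>x. cnj (\<phi> x)) (of_H2 g))"
      by (rule cinner_L2_commute[symmetric])
    finally show "cinner_H2 (toeplitz \<phi> f) g = cinner_H2 f (toeplitz (\<lambda>x. cnj (\<phi> x)) g)"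
      using assms by (simp add: cinner_toeplitz cinner_mult_op)
  qed
  fix S assume S: "\<forall>f g. cinner_H2 (toeplitz \<phi> f) g = cinner_H2 f (S g)"
  show "S = toeplitz (\<lambda>x. cnj (\<phi> x))"
  proof (intro ext cinner_H2_eqI)
    fix g f
    show "cinner_H2 (S g) f = cinner_H2 (toeplitz (\<lambda>x. cnj (\<phi> x)) g) f"
      using S * by (subst (1 2) cinner_H2_commute) simp
  qed
qed

text \<open>Multiplication by \<open>s\<close> already maps H^2 into itself, so the projection in
  \<open>T_s\<close> acts as the identity.\<close>

lemma of_H2_T_s: "of_H2 (T_s f) = mult_op fst (of_H2 f)"
proof -
  have "\<exists>h. mult_op fst (of_H2 f) = of_H2 h"
    unfolding H2_iff by (auto simp: fourier_U_mult_fst fourier_U_of_H2)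
  then show ?thesis
    by (auto simp: T_s_def toeplitz_def Pr_of_H2)
qed

lemma of_H2_T_p: "of_H2 (T_p f) = mult_op snd (of_H2 f)"
proof -
  have "\<exists>h. mult_op snd (of_H2 f) = of_H2 h"
    unfolding H2_iff by (auto simp: fourier_U_mult_snd fourier_U_of_H2)
  then show ?thesis
    by (auto simp: T_p_def toeplitz_def Pr_of_H2)
qed

lemma cinner_adjoint_T_s: "cinner_H2 (adjoint_H2 T_s f) g = cinner_H2 f (T_s g)"
  unfolding T_s_def adjoint_toeplitz[OF coordinates_Linfty(1)] cinner_toeplitz
  unfolding T_s_def[symmetric] cinner_H2.rep_eq of_H2_T_s
  by (simp add: cinner_mult_op Linfty_cnj coordinates_Linfty)

lemma cinner_adjoint_T_p: "cinner_H2 (adjoint_H2 T_p f) g = cinner_H2 f (T_p g)"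
  unfolding T_p_def adjoint_toeplitz[OF coordinates_Linfty(2)] cinner_toeplitz
  unfolding T_p_def[symmetric] cinner_H2.rep_eq of_H2_T_p
  by (simp add: cinner_mult_op Linfty_cnj coordinates_Linfty)

definition one_H2 :: H2_G where
  "one_H2 = Abs_H2 (abs_L2_bGamma (\<lambda>_. 1))"

lemma of_H2_one: "of_H2 one_H2 = abs_L2_bGamma (\<lambda>_. 1)"
  unfolding one_H2_def by (rule Abs_H2_inverse) (simp add: fourier_U_one)

text \<open>Weak form of the relations: the adjoints have moved to the second argument, so that only
  genuine multiplications by \<open>s\<close> and \<open>p\<close> remain. The locale
  \<open>brown_halmos\<close> assumes this form.\<close>

lemma brown_halmos_iff:
  "adjoint_H2 T_s \<circ> T \<circ> T_p = T \<circ> T_s \<and> adjoint_H2 T_p \<circ> T \<circ> T_p = T \<longleftrightarrow>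
    (\<forall>f g. cinner_H2 (T (T_p f)) (T_s g) = cinner_H2 (T (T_s f)) g) \<and>
    (\<forall>f g. cinner_H2 (T (T_p f)) (T_p g) = cinner_H2 (T f) g)"
proof -
  have "f = h \<longleftrightarrow> (\<forall>x g. cinner_H2 (f x) g = cinner_H2 (h x) g)" for f h :: "H2_G \<Rightarrow> H2_G"
    using cinner_H2_eqI by (metis ext)
  then show ?thesis
    by (simp add: cinner_adjoint_T_s cinner_adjoint_T_p)
qed

text \<open>In weak form no projection is left, and all factors collect into one multiplier, which
  simplifies pointwise on \<open>bGamma\<close>.\<close>

lemma toeplitz_brown_halmos:
  assumes \<phi>: "\<phi> \<in> Linfty_bGamma"
  shows "adjoint_H2 T_s \<circ> toeplitz \<phi> \<circ> T_p = toeplitz \<phi> \<circ> T_s \<and>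
    adjoint_H2 T_p \<circ> toeplitz \<phi> \<circ> T_p = toeplitz \<phi>"
  unfolding brown_halmos_iff
proof (intro conjI allI)
  note L = Linfty_mult Linfty_cnj \<phi> coordinates_Linfty
  have move: "cinner_L2 (mult_op \<phi> (mult_op \<eta> F)) (mult_op \<psi> G) =
      cinner_L2 (mult_op (\<lambda>x. \<phi> x * (cnj (\<psi> x) * \<eta> x)) F) G"
    if "\<eta> \<in> Linfty_bGamma" "\<psi> \<in> Linfty_bGamma" for \<eta> \<psi> F G
  proof -
    \<comment> \<open>The double conjugation lets \<open>cinner_mult_op\<close> be applied from
      right to left.\<close>
    have "mult_op \<psi> G = mult_op (\<lambda>x. cnj (cnj (\<psi> x))) G"
      by simp
    then show ?thesis
      using that \<phi> by (simp only: cinner_mult_op[symmetric] Linfty_cnj mult_op_mult Linfty_mult)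
        (simp add: mult_ac)
  qed
  fix f g
  show "cinner_H2 (toeplitz \<phi> (T_p f)) (T_s g) = cinner_H2 (toeplitz \<phi> (T_s f)) g"
    unfolding cinner_toeplitz of_H2_T_s of_H2_T_p move[OF coordinates_Linfty(2,1)]
      mult_op_mult[OF \<phi> coordinates_Linfty(1)]
    by (intro arg_cong2[where f = cinner_L2] mult_op_cong refl L, simp add: cnj_fst_mult_snd_bGamma)
  show "cinner_H2 (toeplitz \<phi> (T_p f)) (T_p g) = cinner_H2 (toeplitz \<phi> f) g"
    unfolding cinner_toeplitz of_H2_T_p
    by (simp only: move coordinates_Linfty \<phi>)
      (intro arg_cong2[where f = cinner_L2] mult_op_cong refl L, simp add: cnj_snd_mult_snd_bGamma)
qed

section \<open>Density of Laurent polynomials\<close>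

text \<open>Generation by closure rules allows rule induction: whatever holds for multiplication by
  \<open>s\<close> and \<open>p\<close> extends to all polynomials, without handling
  coefficients.\<close>

inductive_set poly_bGamma :: "(complex \<times> complex \<Rightarrow> complex) set" where
  const: "(\<lambda>_. c) \<in> poly_bGamma"
| fst: "fst \<in> poly_bGamma"
| snd: "snd \<in> poly_bGamma"
| add: "f \<in> poly_bGamma \<Longrightarrow> g \<in> poly_bGamma \<Longrightarrow> (\<lambda>x. f x + g x) \<in> poly_bGamma"
| mult: "f \<in> poly_bGamma \<Longrightarrow> g \<in> poly_bGamma \<Longrightarrow> (\<lambda>x. f x * g x) \<in> poly_bGamma"

lemma poly_power: "f \<in> poly_bGamma \<Longrightarrow> (\<lambda>x. f x ^ n) \<in> poly_bGamma"
  by (induction n) (simp_all add: poly_bGamma.intros)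

lemma poly_Linfty: "q \<in> poly_bGamma \<Longrightarrow> q \<in> Linfty_bGamma"
  by (induction rule: poly_bGamma.induct)
    (auto intro: Linfty_const coordinates_Linfty Linfty_add Linfty_mult)

text \<open>On \<open>bGamma\<close> the conjugate of \<open>p\<close> is its inverse, so this is a
  polynomial over a power of \<open>p\<close>. Equality is demanded only there, since the identities
  between \<open>s\<close>, \<open>p\<close> and their conjugates fail elsewhere.\<close>

definition laurent :: "(complex \<times> complex \<Rightarrow> complex) \<Rightarrow> bool" where
  "laurent f \<longleftrightarrow> (\<exists>n. \<exists>q\<in>poly_bGamma. \<forall>x\<in>bGamma. f x = cnj (snd x) ^ n * q x)"

lemma laurentI: "q \<in> poly_bGamma \<Longrightarrow> (\<And>x. x \<in> bGamma \<Longrightarrow> f x = cnj (snd x) ^ n * q x) \<Longrightarrow> laurent f"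
  unfolding laurent_def by blast

lemma cnj_snd_power_mult_bGamma: "x \<in> bGamma \<Longrightarrow> cnj (snd x) ^ n * snd x ^ n = 1"
  by (simp add: cnj_snd_mult_snd_bGamma flip: power_mult_distrib)

lemma laurent_poly: "q \<in> poly_bGamma \<Longrightarrow> laurent q"
  by (rule laurentI[where n = 0]) auto

lemma laurent_cong: "laurent f \<Longrightarrow> (\<And>x. x \<in> bGamma \<Longrightarrow> f x = g x) \<Longrightarrow> laurent g"
  unfolding laurent_def by simp

text \<open>The sum is brought to the common denominator \<open>p ^ (m + n)\<close>.\<close>

lemma laurent_add:
  assumes "laurent f" "laurent g"
  shows "laurent (\<lambda>x. f x + g x)"
proof -
  obtain m q where q: "q \<in> poly_bGamma" "\<And>x. x \<in> bGamma \<Longrightarrow> f x = cnj (snd x) ^ m * q x"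
    using assms(1) by (auto simp: laurent_def)
  obtain n r where r: "r \<in> poly_bGamma" "\<And>x. x \<in> bGamma \<Longrightarrow> g x = cnj (snd x) ^ n * r x"
    using assms(2) by (auto simp: laurent_def)
  show ?thesis
  proof (rule laurentI)
    show "(\<lambda>x. snd x ^ n * q x + snd x ^ m * r x) \<in> poly_bGamma"
      using q r by (intro poly_bGamma.intros poly_power)
    fix x assume x: "x \<in> bGamma"
    have "cnj (snd x) ^ (m + n) * (snd x ^ n * q x + snd x ^ m * r x) =
        cnj (snd x) ^ m * q x * (cnj (snd x) ^ n * snd x ^ n) +
        cnj (snd x) ^ n * r x * (cnj (snd x) ^ m * snd x ^ m)"
      by (simp add: power_add algebra_simps)
    then show "f x + g x = cnj (snd x) ^ (m + n) * (snd x ^ n * q x + snd x ^ m * r x)"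
      unfolding cnj_snd_power_mult_bGamma[OF x] by (simp add: q r x)
  qed
qed

lemma laurent_mult:
  assumes "laurent f" "laurent g"
  shows "laurent (\<lambda>x. f x * g x)"
proof -
  obtain m q where q: "q \<in> poly_bGamma" "\<And>x. x \<in> bGamma \<Longrightarrow> f x = cnj (snd x) ^ m * q x"
    using assms(1) by (auto simp: laurent_def)
  obtain n r where r: "r \<in> poly_bGamma" "\<And>x. x \<in> bGamma \<Longrightarrow> g x = cnj (snd x) ^ n * r x"
    using assms(2) by (auto simp: laurent_def)
  show ?thesis
    by (rule laurentI[OF poly_bGamma.mult[OF q(1) r(1)], of _ "m + n"])
      (simp add: q r power_add mult_ac)
qed

lemma laurent_const: "laurent (\<lambda>_. c)"
  and laurent_fst: "laurent fst"
  and laurent_snd: "laurent snd"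
  by (auto intro: laurent_poly poly_bGamma.intros)

lemma laurent_cnj_snd: "laurent (\<lambda>x. cnj (snd x))"
  by (rule laurentI[OF poly_bGamma.const[of 1], of _ 1]) simp

text \<open>With this, conjugates of both coordinates are Laurent polynomials, hence also their real
  and imaginary parts.\<close>

lemma laurent_cnj_fst: "laurent (\<lambda>x. cnj (fst x))"
proof (rule laurent_cong[OF laurent_mult[OF laurent_fst laurent_cnj_snd]])
  fix x assume x: "x \<in> bGamma"
  have "fst x * cnj (snd x) = cnj (fst x) * (cnj (snd x) * snd x)"
    using cnj_fst_mult_snd_bGamma[OF x] by (simp add: mult_ac)
  then show "fst x * cnj (snd x) = cnj (fst x)"
    by (simp add: cnj_snd_mult_snd_bGamma[OF x])
qed

lemma laurent_Re_Im:
  assumes f: "laurent f" "laurent (\<lambda>x. cnj (f x))"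
  shows "laurent (\<lambda>x. of_real (Re (f x)))" "laurent (\<lambda>x. of_real (Im (f x)))"
proof -
  show "laurent (\<lambda>x. of_real (Re (f x)))"
    by (rule laurent_cong[OF laurent_mult[OF laurent_const[of "1/2"] laurent_add[OF f]]])
      (simp add: complex_eq_iff)
  show "laurent (\<lambda>x. of_real (Im (f x)))"
    by (rule laurent_cong[OF laurent_mult[OF laurent_const[of "- \<i> / 2"]
          laurent_add[OF f(1) laurent_mult[OF laurent_const[of "- 1"] f(2)]]]])
      (simp add: complex_eq_iff)
qed

text \<open>Link to the real form of Stone-Weierstrass: a real linear functional on pairs of complex
  numbers is a real combination of the real and imaginary parts of the coordinates.\<close>

lemma laurent_real_polynomial:
  "real_polynomial_function f \<Longrightarrow> laurent (\<lambda>x. of_real (f x))"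
proof (induction rule: real_polynomial_function.induct)
  case (linear f)
  then interpret f: bounded_linear f .
  define a b c d where abcd: "a = f (1, 0)" "b = f (\<i>, 0)" "c = f (0, 1)" "d = f (0, \<i>)"
  have eq: "f x = Re (fst x) * a + Im (fst x) * b + (Re (snd x) * c + Im (snd x) * d)" for x
  proof -
    have "x = (Re (fst x) *\<^sub>R (1, 0) + Im (fst x) *\<^sub>R (\<i>, 0)) +
        (Re (snd x) *\<^sub>R (0, 1) + Im (snd x) *\<^sub>R (0, \<i>))"
      by (auto simp: prod_eq_iff complex_eq_iff)
    then have "f x = f ((Re (fst x) *\<^sub>R (1, 0) + Im (fst x) *\<^sub>R (\<i>, 0)) +
        (Re (snd x) *\<^sub>R (0, 1) + Im (snd x) *\<^sub>R (0, \<i>)))"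
      by (rule arg_cong)
    then show ?thesis
      unfolding f.add f.scaleR real_scaleR_def abcd .
  qed
  show ?case
    unfolding eq of_real_add of_real_mult
    by (intro laurent_add laurent_mult laurent_const laurent_Re_Im laurent_fst laurent_snd
        laurent_cnj_fst laurent_cnj_snd)
qed (simp_all add: laurent_const laurent_add laurent_mult)

section \<open>Mean square approximation by Laurent polynomials\<close>

lemma compact_bGamma: "compact bGamma"
  unfolding bGamma_def symm_map_def[abs_def]
  by (intro compact_continuous_image continuous_intros compact_Times) auto

lemma laurent_bounded:
  assumes "laurent a" "a \<in> borel_measurable nu"
  shows "a \<in> Linfty_bGamma"
proof -
  obtain n q where q: "q \<in> poly_bGamma" "\<And>x. x \<in> bGamma \<Longrightarrow> a x = cnj (snd x) ^ n * q x"
    using assms(1) by (auto simp: laurent_def)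
  obtain C where C: "AE x in nu. cmod (q x) \<le> C"
    using poly_Linfty[OF q(1)] by (auto simp: Linfty_bGamma_def)
  have "AE x in nu. x \<in> bGamma"
    using AE_space[of nu] by simp
  with C have "AE x in nu. cmod (a x) \<le> C"
    by eventually_elim (simp add: q norm_mult norm_power norm_snd_bGamma)
  then show ?thesis
    using assms(2) by (auto simp: Linfty_bGamma_def)
qed

text \<open>The measure is a parameter because the result is needed twice: for \<open>nu\<close>
  itself and for a weighted version of \<open>nu\<close> that depends on the symbol.\<close>

locale bGamma_measure = finite_measure M for M :: "(complex \<times> complex) measure" +
  assumes sets_M: "sets M = sets nu"
begin

lemma space_M: "space M = bGamma"
  using sets_eq_imp_space_eq[OF sets_M] by simp

lemma measurable_M: "f \<in> borel_measurable M \<longleftrightarrow> f \<in> borel_measurable nu"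
  using measurable_cong_sets[OF sets_M refl] by auto

definition sq_norm :: "(complex \<times> complex \<Rightarrow> complex) \<Rightarrow> ennreal" where
  "sq_norm f = (\<integral>\<^sup>+x. ennreal ((cmod (f x))\<^sup>2) \<partial>M)"

definition approximable :: "(complex \<times> complex \<Rightarrow> complex) \<Rightarrow> bool" where
  "approximable f \<longleftrightarrow> f \<in> borel_measurable M \<and>
    (\<forall>e>0. \<exists>a. laurent a \<and> a \<in> borel_measurable M \<and> sq_norm (\<lambda>x. f x - a x) \<le> ennreal e)"

text \<open>Squared norms are compared, so \<open>|x + y|^2 \<le> 2 |x|^2 + 2 |y|^2\<close> replaces
  the triangle inequality; this is the origin of \<open>e / 4\<close>.\<close>

lemma sq_norm_add:
  assumes [measurable]: "f \<in> borel_measurable M" "g \<in> borel_measurable M"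
    and le: "sq_norm f \<le> ennreal (e / 4)" "sq_norm g \<le> ennreal (e / 4)" and e: "e \<ge> 0"
  shows "sq_norm (\<lambda>x. f x + g x) \<le> ennreal e"
proof -
  have sq: "ennreal ((cmod (x + y))\<^sup>2) \<le> 2 * ennreal ((cmod x)\<^sup>2) + 2 * ennreal ((cmod y)\<^sup>2)" for x y
  proof -
    have "(cmod (x + y))\<^sup>2 \<le> (cmod x + cmod y)\<^sup>2"
      by (intro power_mono norm_triangle_ineq) auto
    also have "\<dots> \<le> 2 * (cmod x)\<^sup>2 + 2 * (cmod y)\<^sup>2"
      using sum_squares_bound[of "cmod x" "cmod y"] by (simp add: power2_sum)
    finally have "ennreal ((cmod (x + y))\<^sup>2) \<le> ennreal (2 * (cmod x)\<^sup>2 + 2 * (cmod y)\<^sup>2)"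
      by (rule ennreal_leI)
    then show ?thesis
      by (simp add: ennreal_plus ennreal_mult)
  qed
  have "sq_norm (\<lambda>x. f x + g x) \<le>
      (\<integral>\<^sup>+x. 2 * ennreal ((cmod (f x))\<^sup>2) + 2 * ennreal ((cmod (g x))\<^sup>2) \<partial>M)"
    unfolding sq_norm_def by (intro nn_integral_mono sq)
  also have "\<dots> = 2 * sq_norm f + 2 * sq_norm g"
    unfolding sq_norm_def by (subst nn_integral_add) (auto simp: nn_integral_cmult)
  also have "\<dots> \<le> 2 * ennreal (e / 4) + 2 * ennreal (e / 4)"
    by (intro add_mono mult_left_mono le) auto
  also have "\<dots> = ennreal (2 * (e / 4) + 2 * (e / 4))"
    using e by (simp only: ennreal_plus[of "2 * (e / 4)" "2 * (e / 4)"] ennreal_mult) (simp add: ennreal_mult ennreal_plus)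
  finally show ?thesis
    by simp
qed

lemma approximable_limit:
  assumes f: "f \<in> borel_measurable M"
    and g: "\<And>e. e > 0 \<Longrightarrow> \<exists>g. approximable g \<and> sq_norm (\<lambda>x. f x - g x) \<le> ennreal e"
  shows "approximable f"
  unfolding approximable_def
proof (intro conjI allI impI f)
  fix e :: real assume e: "e > 0"
  obtain g where g: "approximable g" "sq_norm (\<lambda>x. f x - g x) \<le> ennreal (e / 4)"
    using g[of "e / 4"] e by auto
  then obtain a where a: "laurent a" "a \<in> borel_measurable M" "sq_norm (\<lambda>x. g x - a x) \<le> ennreal (e / 4)"
    using e unfolding approximable_def by (meson divide_pos_pos zero_less_numeral)
  have "g \<in> borel_measurable M"
    using g(1) by (simp add: approximable_def)
  then have "sq_norm (\<lambda>x. (f x - g x) + (g x - a x)) \<le> ennreal e"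
    using e by (intro sq_norm_add g a borel_measurable_diff f) auto
  then show "\<exists>a. laurent a \<and> a \<in> borel_measurable M \<and> sq_norm (\<lambda>x. f x - a x) \<le> ennreal e"
    using a by auto
qed

lemma approximable_add:
  assumes f: "approximable f" and g: "approximable g"
  shows "approximable (\<lambda>x. f x + g x)"
  unfolding approximable_def
proof (intro conjI allI impI)
  have m: "f \<in> borel_measurable M" "g \<in> borel_measurable M"
    using f g by (auto simp: approximable_def)
  then show "(\<lambda>x. f x + g x) \<in> borel_measurable M"
    by simp
  fix e :: real assume e: "e > 0"
  obtain a where a: "laurent a" "a \<in> borel_measurable M" "sq_norm (\<lambda>x. f x - a x) \<le> ennreal (e / 4)"
    using f e unfolding approximable_def by (meson divide_pos_pos zero_less_numeral)
  obtain b where b: "laurent b" "b \<in> borel_measurable M" "sq_norm (\<lambda>x. g x - b x) \<le> ennreal (e / 4)"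
    using g e unfolding approximable_def by (meson divide_pos_pos zero_less_numeral)
  have "sq_norm (\<lambda>x. (f x - a x) + (g x - b x)) \<le> ennreal e"
    using e by (intro sq_norm_add a b borel_measurable_diff m) auto
  then show "\<exists>c. laurent c \<and> c \<in> borel_measurable M \<and> sq_norm (\<lambda>x. f x + g x - c x) \<le> ennreal e"
    using a b by (intro exI[of _ "\<lambda>x. a x + b x"]) (auto simp: laurent_add algebra_simps)
qed

lemma approximable_scale:
  assumes f: "approximable f"
  shows "approximable (\<lambda>x. c * f x)"
  unfolding approximable_def
proof (intro conjI allI impI)
  have m [measurable]: "f \<in> borel_measurable M"
    using f by (auto simp: approximable_def)
  then show "(\<lambda>x. c * f x) \<in> borel_measurable M"
    by simp
  fix e :: real assume e: "e > 0"
  \<comment> \<open>Adding 1 keeps \<open>d\<close> positive when \<open>c = 0\<close>.\<close>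
  define d where "d = (cmod c)\<^sup>2 + 1"
  have d: "d > 0"
    by (simp add: d_def add_nonneg_pos)
  obtain a where a [measurable]: "laurent a" "a \<in> borel_measurable M" "sq_norm (\<lambda>x. f x - a x) \<le> ennreal (e / d)"
    using f e d unfolding approximable_def by (meson divide_pos_pos)
  have "ennreal ((cmod (c * f x - c * a x))\<^sup>2) \<le> ennreal d * ennreal ((cmod (f x - a x))\<^sup>2)" for x
    unfolding right_diff_distrib[symmetric] norm_mult power_mult_distrib d_def
    by (subst ennreal_mult[symmetric]) (auto intro!: ennreal_leI mult_right_mono)
  then have "sq_norm (\<lambda>x. c * f x - c * a x) \<le> (\<integral>\<^sup>+x. ennreal d * ennreal ((cmod (f x - a x))\<^sup>2) \<partial>M)"
    unfolding sq_norm_def by (intro nn_integral_mono)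
  also have "\<dots> = ennreal d * sq_norm (\<lambda>x. f x - a x)"
    unfolding sq_norm_def by (intro nn_integral_cmult) (use a in measurable)
  also have "\<dots> \<le> ennreal d * ennreal (e / d)"
    by (intro mult_left_mono a) auto
  also have "\<dots> = ennreal e"
    using d e by (simp flip: ennreal_mult)
  finally show "\<exists>a. laurent a \<and> a \<in> borel_measurable M \<and> sq_norm (\<lambda>x. c * f x - a x) \<le> ennreal e"
    using a by (intro exI[of _ "\<lambda>x. c * a x"]) (auto simp: laurent_mult laurent_const)
qed

lemma approximable_const: "approximable (\<lambda>_. c)"
  unfolding approximable_def
  by (auto intro!: exI[of _ "\<lambda>_. c"] simp: laurent_const sq_norm_def)

lemma approximable_sum:
  "finite I \<Longrightarrow> (\<And>i. i \<in> I \<Longrightarrow> approximable (f i)) \<Longrightarrow> approximable (\<lambda>x. \<Sum>i\<in>I. f i x)"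
  by (induction I rule: finite_induct) (auto simp: approximable_const approximable_add)

lemma approximable_dominated:
  assumes f [measurable]: "f \<in> borel_measurable M" and g: "\<And>i::nat. approximable (g i)"
    and w [measurable]: "w \<in> borel_measurable M" and w_fin: "(\<integral>\<^sup>+x. ennreal ((w x)\<^sup>2) \<partial>M) < \<infinity>"
    and bound: "\<And>i x. x \<in> bGamma \<Longrightarrow> cmod (f x - g i x) \<le> w x"
    and lim: "\<And>x. x \<in> bGamma \<Longrightarrow> (\<lambda>i. g i x) \<longlonglongrightarrow> f x"
  shows "approximable f"
proof (rule approximable_limit[OF f])
  fix e :: real assume e: "e > 0"
  have [measurable]: "g i \<in> borel_measurable M" for i
    using g by (simp add: approximable_def)
  have "(\<lambda>i. sq_norm (\<lambda>x. f x - g i x)) \<longlonglongrightarrow> (\<integral>\<^sup>+x. 0 \<partial>M)"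
    unfolding sq_norm_def
  proof (rule nn_integral_dominated_convergence[where w = "\<lambda>x. ennreal ((w x)\<^sup>2)"])
    show "AE x in M. ennreal ((cmod (f x - g j x))\<^sup>2) \<le> ennreal ((w x)\<^sup>2)" for j
      using bound by (intro AE_I2) (auto simp: space_M intro!: ennreal_leI power_mono)
    have "(\<lambda>i. ennreal ((cmod (f x - g i x))\<^sup>2)) \<longlonglongrightarrow> ennreal ((cmod (f x - f x))\<^sup>2)" if "x \<in> bGamma" for x
      by (intro tendsto_intros lim that)
    then show "AE x in M. (\<lambda>i. ennreal ((cmod (f x - g i x))\<^sup>2)) \<longlonglongrightarrow> 0"
      by (intro AE_I2) (simp add: space_M)
  qed (use w_fin in auto)
  then have "\<forall>\<^sub>F i in sequentially. sq_norm (\<lambda>x. f x - g i x) < ennreal e"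
    using e by (intro order_tendstoD(2)) auto
  then obtain i where "sq_norm (\<lambda>x. f x - g i x) < ennreal e"
    by (auto simp: eventually_sequentially)
  then show "\<exists>g. approximable g \<and> sq_norm (\<lambda>x. f x - g x) \<le> ennreal e"
    using g[of i] by (intro exI[of _ "g i"]) auto
qed

lemma approximable_bounded:
  assumes f: "f \<in> borel_measurable M" and g: "\<And>i::nat. approximable (g i)"
    and bound: "\<And>i x. x \<in> bGamma \<Longrightarrow> cmod (f x - g i x) \<le> B"
    and lim: "\<And>x. x \<in> bGamma \<Longrightarrow> (\<lambda>i. g i x) \<longlonglongrightarrow> f x"
  shows "approximable f"
proof (rule approximable_dominated[OF f g _ _ bound lim])
  show "(\<integral>\<^sup>+x. ennreal (B\<^sup>2) \<partial>M) < \<infinity>"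
    by (simp add: ennreal_mult_eq_top_iff less_top[symmetric])
qed auto

lemma approximable_continuous:
  fixes g :: "complex \<times> complex \<Rightarrow> real"
  assumes g: "continuous_on UNIV g"
  shows "approximable (\<lambda>x. of_real (g x))"
  unfolding approximable_def
proof (intro conjI allI impI)
  have cont: "h \<in> borel_measurable M" if "continuous_on UNIV h" for h :: "complex \<times> complex \<Rightarrow> complex"
    unfolding measurable_M measurable_cong_sets[OF sets_nu refl]
    by (intro measurable_restrict_space1 borel_measurable_continuous_onI that)
  show "(\<lambda>x. complex_of_real (g x)) \<in> borel_measurable M"
    by (intro cont continuous_intros g)
  fix e :: real assume e: "e > 0"
  \<comment> \<open>A uniform error \<open>d\<close> costs at most \<open>d^2\<close> times the
    total mass; the added 1 covers a measure of mass 0.\<close>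
  define d where "d = sqrt (e / (measure M (space M) + 1))"
  have m: "measure M (space M) + 1 > 0"
    by (simp add: add_nonneg_pos)
  then have d: "d > 0"
    using e by (simp add: d_def)
  obtain h where h: "real_polynomial_function h" "\<And>x. x \<in> bGamma \<Longrightarrow> \<bar>g x - h x\<bar> < d"
    using Stone_Weierstrass_real_polynomial_function[OF compact_bGamma continuous_on_subset[OF g] d] by auto
  have "sq_norm (\<lambda>x. of_real (g x) - of_real (h x)) \<le> (\<integral>\<^sup>+x. ennreal (d\<^sup>2) \<partial>M)"
    unfolding sq_norm_def
  proof (intro nn_integral_mono ennreal_leI power_mono)
    fix x assume "x \<in> space M"
    then show "cmod (of_real (g x) - of_real (h x)) \<le> d"
      using h(2)[of x] by (simp add: space_M flip: of_real_diff)
  qed auto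
  also have "\<dots> = ennreal (d\<^sup>2 * measure M (space M))"
    by (simp add: emeasure_eq_measure ennreal_mult)
  also have "\<dots> \<le> ennreal e"
    using e m by (intro ennreal_leI) (simp add: d_def field_simps)
  finally show "\<exists>a. laurent a \<and> a \<in> borel_measurable M \<and> sq_norm (\<lambda>x. of_real (g x) - a x) \<le> ennreal e"
    using h(1)
    by (intro exI[of _ "\<lambda>x. of_real (h x)"] conjI laurent_real_polynomial cont
        continuous_on_of_real continuous_on_polymonial_function)
      (auto simp: real_polynomial_function_eq)
qed


lemma indicator_measurable_M: "A \<in> sets borel \<Longrightarrow> (\<lambda>x. indicator A x :: complex) \<in> borel_measurable M"
  unfolding measurable_M measurable_cong_sets[OF sets_nu refl]
  by (intro measurable_restrict_space1 borel_measurable_indicator)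

lemma approximable_indicator_closed:
  assumes A: "closed A"
  shows "approximable (indicator A)"
\<comment> \<open>The empty set is separate because \<open>infdist x {}\<close> is 0 by convention,
  so the functions below would be constantly 1.\<close>
proof (cases "A = {}")
  case True
  then show ?thesis
    using approximable_const[of 0] by (simp add: indicator_def[abs_def])
next
  case False
  \<comment> \<open>Continuous functions equal to 1 on \<open>A\<close> that vanish as soon as
    \<open>n\<close> times the distance to \<open>A\<close> reaches 1; they decrease to the
    indicator because \<open>A\<close> is closed.\<close>
  define g where "g n x = max 0 (1 - real n * infdist x A)" for n and x :: "complex \<times> complex"
  have lim: "(\<lambda>n. complex_of_real (g n x)) \<longlonglongrightarrow> indicator A x" for x
  proof (cases "x \<in> A")
    case True
    then show ?thesis
      by (simp add: g_def)
  next
    case x: False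
    then have pos: "infdist x A > 0"
      using A False infdist_nonneg[of x A] in_closed_iff_infdist_zero[of A x] by auto
    obtain N where N: "1 < real N * infdist x A"
      using reals_Archimedean3[OF pos] by auto
    have "complex_of_real (g n x) = 0" if "n \<ge> N" for n
    proof -
      have "real N * infdist x A \<le> real n * infdist x A"
        using that pos by (intro mult_right_mono) auto
      then show ?thesis
        using N by (simp add: g_def)
    qed
    then show ?thesis
      using x by (intro tendsto_eventually eventually_sequentiallyI[of N]) simp
  qed
  have g: "0 \<le> g n x" "g n x \<le> 1" for n x
    using infdist_nonneg[of x A] by (auto simp: g_def)
  show ?thesis
  proof (rule approximable_bounded[where g = "\<lambda>n x. of_real (g n x)" and B = 2])
    show "approximable (\<lambda>x. of_real (g n x))" for n
      unfolding g_def by (intro approximable_continuous continuous_intros)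
    show "cmod (indicator A x - of_real (g n x)) \<le> 2" for n x
      using g[of n x] norm_triangle_ineq4[of "indicator A x" "complex_of_real (g n x)"]
      by (auto simp: indicator_def split: if_splits)
  qed (use A lim indicator_measurable_M in auto)
qed

text \<open>Dynkin's argument: closed sets are stable under intersection and generate the Borel
  sets, and approximability passes to complements and disjoint countable unions.\<close>

lemma approximable_indicator:
  assumes "A \<in> sets borel"
  shows "approximable (indicator A)"
proof -
  have "Int_stable (Collect closed :: (complex \<times> complex) set set)"
    by (auto simp: Int_stable_def)
  moreover have "Collect closed \<subseteq> Pow (UNIV :: (complex \<times> complex) set)"
    by simp
  moreover have "A \<in> sigma_sets UNIV (Collect closed)"
    using assms by (simp add: borel_eq_closed)
  ultimately show ?thesis
  proof (induction rule: sigma_sets_induct_disjoint)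
    case (basic A)
    then show ?case
      by (simp add: approximable_indicator_closed)
  next
    case empty
    show ?case
      by (rule approximable_indicator_closed) simp
  next
    case (compl A)
    have "approximable (\<lambda>x. 1 + (- 1) * indicator A x)"
      by (intro approximable_add approximable_const approximable_scale compl)
    then show ?case
      by (rule back_subst[where P = approximable]) (auto simp: indicator_def)
  next
    case (union A)
    have "A i \<in> sets borel" for i
      using union(2) by (auto simp: borel_eq_closed)
    then have U: "(\<Union>i. A i) \<in> sets borel"
      by auto
    have sum: "(\<Sum>i<n. indicator (A i) x) = (indicator (\<Union>i<n. A i) x :: complex)" for n x
      by (rule indicator_UN_disjoint[symmetric])
        (use union(1) in \<open>auto intro: disjoint_family_on_mono\<close>)
    show ?case
    proof (rule approximable_bounded[where g = "\<lambda>n x. \<Sum>i<n. indicator (A i) x" and B = 2])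
      show "approximable (\<lambda>x. \<Sum>i<n. indicator (A i) x)" for n
        by (intro approximable_sum union) auto
      show "cmod (indicator (\<Union>i. A i) x - (\<Sum>i<n. indicator (A i) x)) \<le> 2" for n x
        unfolding sum by (auto simp: indicator_def)
      show "(\<lambda>n. \<Sum>i<n. indicator (A i) x) \<longlonglongrightarrow> (indicator (\<Union>i. A i) x :: complex)" for x
        unfolding sum by (rule LIMSEQ_indicator_UN)
    qed (rule indicator_measurable_M[OF U])
  qed
qed

lemma approximable_indicator_M:
  assumes "A \<in> sets M"
  shows "approximable (indicator A)"
proof -
  obtain B where B: "B \<in> sets borel" "A = B \<inter> bGamma"
    using assms by (auto simp: sets_M sets_nu sets_restrict_space)
  have "bGamma \<in> sets borel"
    using compact_bGamma by (intro borel_closed compact_imp_closed)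
  then show ?thesis
    using B by (simp add: approximable_indicator)
qed

lemma approximable_simple:
  fixes s :: "complex \<times> complex \<Rightarrow> complex"
  assumes s: "simple_function M s"
  shows "approximable (\<lambda>x. \<Sum>y\<in>s ` space M. y * indicator (s -` {y} \<inter> space M) x)"
  using s by (intro approximable_sum approximable_scale approximable_indicator_M)
    (auto simp: simple_function_def)

lemma approximable_square_integrable:
  assumes f: "f \<in> borel_measurable M" and fin: "(\<integral>\<^sup>+x. ennreal ((cmod (f x))\<^sup>2) \<partial>M) < \<infinity>"
  shows "approximable f"
proof -
  obtain s where s: "\<And>i. simple_function M (s i)" "\<And>x. x \<in> space M \<Longrightarrow> (\<lambda>i. s i x) \<longlonglongrightarrow> f x"
    "\<And>i x. x \<in> space M \<Longrightarrow> cmod (s i x) \<le> 2 * cmod (f x)"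
    using borel_measurable_implies_sequence_metric[OF f, of 0] by (auto simp: dist_norm) metis
  \<comment> \<open>The canonical representation of \<open>s i\<close> as a combination of
    indicators, which equals \<open>s i\<close> on \<open>space M\<close>.\<close>
  define t where "t i x = (\<Sum>y\<in>s i ` space M. y * indicator (s i -` {y} \<inter> space M) x)" for i x
  have t: "t i x = s i x" if x: "x \<in> space M" for i x
  proof -
    have "t i x = (\<Sum>y\<in>s i ` space M. if y = s i x then y else 0)"
      unfolding t_def using x by (intro sum.cong) (auto simp: indicator_def)
    also have "\<dots> = s i x"
      using s(1)[of i] x by (subst sum.delta) (auto simp: simple_function_def)
    finally show ?thesis .
  qed
  show ?thesis
  \<comment> \<open>The simple functions satisfy \<open>|s i| \<le> 2 |f|\<close>, so their distance
    to \<open>f\<close> is at most \<open>3 |f|\<close>.\<close>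
  proof (rule approximable_dominated[where g = t and w = "\<lambda>x. 3 * cmod (f x)"])
    show "approximable (t i)" for i
      unfolding t_def by (rule approximable_simple[OF s(1)])
    have "(\<integral>\<^sup>+x. ennreal ((3 * cmod (f x))\<^sup>2) \<partial>M) = (\<integral>\<^sup>+x. 9 * ennreal ((cmod (f x))\<^sup>2) \<partial>M)"
      by (intro nn_integral_cong) (simp add: power_mult_distrib ennreal_mult)
    also have "\<dots> < \<infinity>"
      using f fin by (subst nn_integral_cmult) (auto simp: ennreal_mult_less_top)
    finally show "(\<integral>\<^sup>+x. ennreal ((3 * cmod (f x))\<^sup>2) \<partial>M) < \<infinity>" .
    show "cmod (f x - t i x) \<le> 3 * cmod (f x)" if "x \<in> bGamma" for i x
      using s(3)[of x i] t[of x i] norm_triangle_ineq4[of "f x" "t i x"] that by (simp add: space_M)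
    show "(\<lambda>i. t i x) \<longlonglongrightarrow> f x" if "x \<in> bGamma" for x
      using s(2)[of x] that by (simp add: t space_M)
  qed (use f in auto)
qed

end

section \<open>Operators satisfying the Brown--Halmos relations\<close>

text \<open>The hypothesis makes \<open>x m - x n\<close> orthogonal to \<open>x n\<close>. By
  Pythagoras its squared norm is the difference of the squared norms, which form a bounded
  increasing sequence.\<close>

lemma Cauchy_orthogonal_increments:
  fixes x :: "nat \<Rightarrow> 'a::real_inner"
  assumes inner: "\<And>m n. n \<le> m \<Longrightarrow> x m \<bullet> x n = (norm (x n))\<^sup>2"
    and B: "\<And>n. norm (x n) \<le> B"
  shows "Cauchy x"
proof -
  define a where "a n = (norm (x n))\<^sup>2" for n
  have diff: "(norm (x m - x n))\<^sup>2 = a m - a n" if "n \<le> m" for m n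
    unfolding power2_norm_eq_inner inner_diff_left inner_diff_right
    using inner[OF that] by (simp add: a_def inner_commute[of "x n"] flip: power2_norm_eq_inner)
  have "incseq a"
    using diff by (intro monoI) (metis diff_ge_0_iff_ge zero_le_power2)
  moreover have "a n \<le> B\<^sup>2" for n
    unfolding a_def by (intro power_mono B) auto
  ultimately obtain L where "a \<longlonglongrightarrow> L"
    using incseq_convergent by blast
  then have a: "Cauchy a"
    by (rule LIMSEQ_imp_Cauchy)
  show ?thesis
  proof (rule CauchyI)
    fix e :: real assume e: "e > 0"
    then obtain N where N: "\<And>m n. m \<ge> N \<Longrightarrow> n \<ge> N \<Longrightarrow> norm (a m - a n) < e\<^sup>2"
      using CauchyD[OF a, of "e\<^sup>2"] by auto
    have less: "norm (x m - x n) < e" if "n \<le> m" "N \<le> n" for m n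
    proof (rule power2_less_imp_less)
      show "(norm (x m - x n))\<^sup>2 < e\<^sup>2"
        unfolding diff[OF that(1)] using N[of m n] that by simp
    qed (use e in simp)
    have "norm (x m - x n) < e" if "m \<ge> N" "n \<ge> N" for m n
    proof (cases "n \<le> m")
      case True
      then show ?thesis
        using less that by simp
    next
      case False
      then show ?thesis
        using less[of m n] that by (simp add: norm_minus_commute)
    qed
    then show "\<exists>N. \<forall>m\<ge>N. \<forall>n\<ge>N. norm (x m - x n) < e"
      by blast
  qed
qed

lemma tendsto_mult_op:
  assumes \<phi>: "\<phi> \<in> Linfty_bGamma" and F: "F \<longlonglongrightarrow> G"
  shows "(\<lambda>n. mult_op \<phi> (F n)) \<longlonglongrightarrow> mult_op \<phi> G"
proof -
  obtain C where "AE x in nu. cmod (\<phi> x) \<le> C"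
    using \<phi> by (auto simp: Linfty_bGamma_def)
  then have C: "AE x in nu. cmod (\<phi> x) \<le> \<bar>C\<bar>"
    by eventually_elim simp
  have 0: "(\<lambda>n. \<bar>C\<bar> * norm (F n - G)) \<longlonglongrightarrow> 0"
    using F by (intro tendsto_mult_right_zero tendsto_norm_zero LIM_zero)
  have "(\<lambda>n. mult_op \<phi> (F n) - mult_op \<phi> G) \<longlonglongrightarrow> 0"
    by (rule Lim_null_comparison[OF always_eventually 0])
      (auto simp: norm_mult_op_le[OF \<phi> C] simp flip: mult_op_diff[OF \<phi>])
  then show ?thesis
    by (rule LIM_zero_cancel)
qed

lemma tendsto_cinner_left:
  assumes F: "F \<longlonglongrightarrow> G"
  shows "(\<lambda>n. cinner_L2 (F n) H) \<longlonglongrightarrow> cinner_L2 G H"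
proof -
  have Re: "(\<lambda>n. Re (cinner_L2 (F n) H)) \<longlonglongrightarrow> Re (cinner_L2 G H)" for H
    using tendsto_inner[OF F tendsto_const, of H] by (simp add: inner_L2_bGamma_def)
  have "Im (cinner_L2 G H) = Re (cinner_L2 G (scaleC_L2 \<i> H))" for G
    by (simp add: cinner_L2_scaleC_right)
  then show ?thesis
    using Re by (simp add: tendsto_complex_iff)
qed

interpretation bGamma_measure nu
  by unfold_locales simp

section \<open>Powers of \<open>p\<close> as unitary operators on L^2\<close>

definition up :: "nat \<Rightarrow> L2_bGamma \<Rightarrow> L2_bGamma" where
  "up n = mult_op (\<lambda>x. snd x ^ n)"

definition down :: "nat \<Rightarrow> L2_bGamma \<Rightarrow> L2_bGamma" where
  "down n = mult_op (\<lambda>x. cnj (snd x) ^ n)"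

lemma up_Linfty: "(\<lambda>x. snd x ^ n) \<in> Linfty_bGamma"
  by (intro Linfty_power coordinates_Linfty)

lemma down_Linfty: "(\<lambda>x. cnj (snd x) ^ n) \<in> Linfty_bGamma"
  by (intro Linfty_power Linfty_cnj coordinates_Linfty)

lemma down_up: "down n (up n F) = F"
  unfolding up_def down_def mult_op_mult[OF down_Linfty up_Linfty]
  by (subst (2) mult_op_one[symmetric])
    (intro mult_op_cong Linfty_const Linfty_mult up_Linfty down_Linfty cnj_snd_power_mult_bGamma)

lemma up_down: "up n (down n F) = F"
  using down_up[of n F] unfolding up_def down_def
  by (simp only: mult_op_commute[OF up_Linfty down_Linfty])

lemma down_0: "down 0 F = F"
  by (simp add: down_def mult_op_one)

lemma down_Suc: "down (Suc n) F = down n (mult_op (\<lambda>x. cnj (snd x)) F)"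
  by (simp add: down_def mult_op_mult Linfty_cnj coordinates_Linfty down_Linfty mult.commute)

lemma up_Suc: "up (Suc n) F = mult_op snd (up n F)"
  by (simp add: up_def mult_op_mult coordinates_Linfty up_Linfty)

lemma norm_up: "norm (up n F) = norm F"
  unfolding up_def by (rule norm_mult_op_unimodular[OF up_Linfty]) (simp add: norm_power norm_snd_bGamma)

lemma norm_down: "norm (down n F) = norm F"
  unfolding down_def by (rule norm_mult_op_unimodular[OF down_Linfty]) (simp add: norm_power norm_snd_bGamma)

lemma up_diff: "up n (F - G) = up n F - up n G"
  unfolding up_def by (rule mult_op_diff[OF up_Linfty])

lemma cinner_down_down: "cinner_L2 (down n F) (down n G) = cinner_L2 F G"
proof -
  have "cinner_L2 (down n F) (down n G) = cinner_L2 F (up n (down n G))"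
    unfolding down_def[of n] up_def cinner_mult_op[OF down_Linfty] by simp
  then show ?thesis
    by (simp add: up_down)
qed

lemma of_H2_T_p_power: "of_H2 ((T_p ^^ n) f) = up n (of_H2 f)"
proof (induction n)
  case 0
  then show ?case
    by (simp add: up_def mult_op_one)
next
  case (Suc n)
  then show ?case
    by (simp add: of_H2_T_p up_Suc)
qed

lemma norm_T_p_power: "norm ((T_p ^^ n) f) = norm f"
  by (simp add: norm_H2_G.rep_eq of_H2_T_p_power norm_up)

lemma T_p_T_s_commute: "(T_p ^^ n) (T_s f) = T_s ((T_p ^^ n) f)"
  by (rule of_H2_inject[THEN iffD1])
    (simp only: of_H2_T_p_power of_H2_T_s up_def mult_op_commute[OF up_Linfty coordinates_Linfty(1)])

text \<open>The approximant is written through \<open>one_H2\<close> because \<open>q * 1\<close>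
  lies in H^2, where the operators to be compared are defined; only the outer \<open>down n\<close>
  leaves H^2.\<close>

lemma laurent_dense:
  assumes e: "e > 0"
  shows "\<exists>n. \<exists>q\<in>poly_bGamma. norm (F - down n (mult_op q (of_H2 one_H2))) \<le> e"
proof -
  obtain f where f: "square_integrable f" "F = abs_L2_bGamma f"
    by (rule L2_cases)
  have "integrable nu (\<lambda>x. (cmod (f x))\<^sup>2)"
    using f(1) by (simp add: square_integrable_def)
  then have "(\<integral>\<^sup>+x. ennreal ((cmod (f x))\<^sup>2) \<partial>nu) < \<infinity>"
    by (simp add: integrable_iff_bounded)
  then have "approximable f"
    using f(1) by (intro approximable_square_integrable) (auto simp: square_integrable_def)
  then obtain a where a: "laurent a" "a \<in> borel_measurable nu" "sq_norm (\<lambda>x. f x - a x) \<le> ennreal (e\<^sup>2)"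
    unfolding approximable_def using e by (meson zero_less_power)
  have aL: "a \<in> Linfty_bGamma"
    using laurent_bounded a by simp
  obtain n q where q: "q \<in> poly_bGamma" "\<And>x. x \<in> bGamma \<Longrightarrow> a x = cnj (snd x) ^ n * q x"
    using a(1) by (auto simp: laurent_def)
  have s1: "square_integrable (\<lambda>_. 1)"
    by (rule square_integrable_bounded[of _ 1]) auto
  have "down n (mult_op q (of_H2 one_H2)) = mult_op (\<lambda>x. cnj (snd x) ^ n * q x) (of_H2 one_H2)"
    unfolding down_def by (intro mult_op_mult down_Linfty poly_Linfty q)
  also have "\<dots> = mult_op a (of_H2 one_H2)"
    by (intro mult_op_cong Linfty_mult down_Linfty poly_Linfty q aL) (simp add: q(2))
  also have "\<dots> = abs_L2_bGamma a"
    unfolding of_H2_one mult_op_abs[OF aL s1] by simp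
  finally have down: "down n (mult_op q (of_H2 one_H2)) = abs_L2_bGamma a" .
  have sa: "square_integrable a" and sd: "square_integrable (\<lambda>x. f x - a x)"
    using aL f by (auto intro: Linfty_square_integrable square_integrable_diff)
  have "ennreal (LINT x|nu. (cmod (f x - a x))\<^sup>2) \<le> ennreal (e\<^sup>2)"
    using a(3) sd unfolding sq_norm_def
    by (subst (asm) nn_integral_eq_integral) (auto simp: square_integrable_def)
  then have "(LINT x|nu. (cmod (f x - a x))\<^sup>2) \<le> e\<^sup>2"
    by (simp add: ennreal_le_iff)
  moreover have "(norm (F - abs_L2_bGamma a))\<^sup>2 = (LINT x|nu. (cmod (f x - a x))\<^sup>2) / 2"
    unfolding f(2) abs_L2_diff[OF f(1) sa] by (rule norm_abs_L2[OF sd])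
  moreover have "(norm (F - abs_L2_bGamma a))\<^sup>2 \<ge> 0"
    by simp
  ultimately have "(norm (F - abs_L2_bGamma a))\<^sup>2 \<le> e\<^sup>2"
    by linarith
  then have "norm (F - abs_L2_bGamma a) \<le> e"
    by (rule power2_le_imp_le) (use e in simp)
  then show ?thesis
    using q(1) unfolding down[symmetric] by blast
qed

text \<open>The induction is over all \<open>g\<close>, since for a product the second factor is
  applied to the result of the first.\<close>

lemma poly_preserves_H2: "q \<in> poly_bGamma \<Longrightarrow> \<exists>h. of_H2 h = mult_op q (of_H2 g)"
proof (induction arbitrary: g rule: poly_bGamma.induct)
  case (const c)
  show ?case
    by (rule exI[of _ "scaleC_H2 c g"]) (simp add: scaleC_H2.rep_eq mult_op_const)
next
  case fst
  show ?case
    by (rule exI[of _ "T_s g"]) (rule of_H2_T_s)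
next
  case snd
  show ?case
    by (rule exI[of _ "T_p g"]) (rule of_H2_T_p)
next
  case (add a b)
  obtain h k where "of_H2 h = mult_op a (of_H2 g)" "of_H2 k = mult_op b (of_H2 g)"
    using add.IH by blast
  then show ?case
    by (intro exI[of _ "h + k"]) (simp add: plus_H2_G.rep_eq mult_op_plus poly_Linfty add.hyps)
next
  case (mult a b)
  obtain h where "of_H2 h = mult_op b (of_H2 g)"
    using mult.IH by blast
  moreover obtain k where "of_H2 k = mult_op a (of_H2 h)"
    using mult.IH by blast
  ultimately show ?case
    by (intro exI[of _ k]) (simp add: mult_op_mult poly_Linfty mult.hyps)
qed

text \<open>If \<open>F\<close> is orthogonal to the family, then
  \<open>\<parallel>F\<parallel>^2\<close> is the inner product of \<open>F\<close> with
  \<open>F - down n h\<close>, hence at most \<open>\<parallel>F\<parallel> * e\<close> by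
  density.\<close>

lemma down_H2_total:
  assumes "\<And>n g. cinner_L2 F (down n (of_H2 g)) = 0"
  shows "F = 0"
proof -
  have "norm F \<le> 0 + e" if e: "e > 0" for e
  proof -
    obtain n q where q: "q \<in> poly_bGamma" "norm (F - down n (mult_op q (of_H2 one_H2))) \<le> e"
      using laurent_dense[OF e] by blast
    obtain h where h: "of_H2 h = mult_op q (of_H2 one_H2)"
      using poly_preserves_H2[OF q(1)] by blast
    have "cinner_L2 F (F - down n (of_H2 h)) = of_real ((norm F)\<^sup>2)"
      by (simp add: cinner_L2_diff_right assms cinner_L2_self)
    then have "norm F * norm F \<le> norm F * norm (F - down n (of_H2 h))"
      using Re_cinner_L2_le[of F "F - down n (of_H2 h)"] by (simp add: power2_eq_square)
    also have "\<dots> \<le> norm F * e"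
      using q(2) by (intro mult_left_mono) (auto simp: h)
    finally show ?thesis
      using e by (cases "F = 0") auto
  qed
  then have "norm F \<le> 0"
    by (rule field_le_epsilon)
  then show ?thesis
    by simp
qed

locale brown_halmos =
  fixes T :: "H2_G \<Rightarrow> H2_G" and K :: real
  assumes T_add: "T (f + g) = T f + T g"
    and T_scaleC: "T (scaleC_H2 c f) = scaleC_H2 c (T f)"
    and norm_T: "norm (T f) \<le> K * norm f"
    and K: "K > 0"
    and rel_s: "cinner_H2 (T (T_p f)) (T_s g) = cinner_H2 (T (T_s f)) g"
    and rel_p: "cinner_H2 (T (T_p f)) (T_p g) = cinner_H2 (T f) g"
begin

definition trunc :: "nat \<Rightarrow> H2_G \<Rightarrow> L2_bGamma" where
  "trunc n f = down n (of_H2 (T ((T_p ^^ n) f)))"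

lemma norm_trunc: "norm (trunc n f) \<le> K * norm f"
  using norm_T[of "(T_p ^^ n) f"]
  by (simp add: trunc_def norm_down norm_T_p_power flip: norm_H2_G.rep_eq)

text \<open>The spaces \<open>cnj p ^ n * H^2\<close> increase with \<open>n\<close>, because
  \<open>g = cnj p * (p * g)\<close>.\<close>

lemma down_of_H2: "down n (of_H2 g) = down (Suc n) (of_H2 (T_p g))"
proof -
  have "mult_op (\<lambda>x. cnj (snd x)) (of_H2 (T_p g)) = of_H2 g"
    using down_up[of 1 "of_H2 g"] by (simp add: of_H2_T_p up_def down_def)
  then show ?thesis
    by (simp only: down_Suc)
qed

lemma cinner_trunc_Suc: "cinner_L2 (trunc (Suc n) f) (down n (of_H2 g)) = cinner_L2 (trunc n f) (down n (of_H2 g))"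
  \<comment> \<open>The congruence confines the rewriting to the left-hand side; the right-hand side
    has to stay at level \<open>n\<close>. After cancelling \<open>down\<close> this is
    \<open>rel_p\<close> for \<open>p ^ n * f\<close>.\<close>
  unfolding down_of_H2[of n g, THEN arg_cong[where f = "cinner_L2 (trunc (Suc n) f)"]]
  by (simp add: trunc_def cinner_down_down rel_p flip: cinner_H2.rep_eq)

text \<open>Each \<open>trunc n f\<close> is the projection of \<open>trunc (Suc n) f\<close> to \<open>cnj p ^ n H\<^sup>2\<close>.\<close>

lemma cinner_trunc_stable:
  "n \<le> m \<Longrightarrow> cinner_L2 (trunc m f) (down n (of_H2 g)) = cinner_L2 (trunc n f) (down n (of_H2 g))"
proof (induction "m - n" arbitrary: n g)
  case 0
  then show ?case
    by simp
next
  case (Suc k)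
  then have "Suc n \<le> m" "k = m - Suc n"
    by auto
  then have "cinner_L2 (trunc m f) (down (Suc n) (of_H2 (T_p g))) =
      cinner_L2 (trunc (Suc n) f) (down (Suc n) (of_H2 (T_p g)))"
    using Suc.hyps(1) by blast
  then show ?case
    by (simp only: down_of_H2[symmetric] cinner_trunc_Suc)
qed

lemma Cauchy_trunc: "Cauchy (\<lambda>n. trunc n f)"
proof (rule Cauchy_orthogonal_increments[OF _ norm_trunc])
  fix m n :: nat assume "n \<le> m"
  then have "cinner_L2 (trunc m f) (down n (of_H2 g)) = cinner_L2 (trunc n f) (down n (of_H2 g))" for g
    by (rule cinner_trunc_stable)
  \<comment> \<open>For this \<open>g\<close> the test vector \<open>down n (of_H2 g)\<close> is
    \<open>trunc n f\<close> itself.\<close>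
  from this[of "T ((T_p ^^ n) f)"]
  have "cinner_L2 (trunc m f) (trunc n f) = cinner_L2 (trunc n f) (trunc n f)"
    by (simp only: trunc_def[of n])
  then show "trunc m f \<bullet> trunc n f = (norm (trunc n f))\<^sup>2"
    by (simp add: inner_L2_bGamma_def cinner_L2_self)
qed

definition dilation :: "H2_G \<Rightarrow> L2_bGamma" where
  "dilation f = lim (\<lambda>n. trunc n f)"

lemma trunc_tendsto: "(\<lambda>n. trunc n f) \<longlonglongrightarrow> dilation f"
  using L2_Cauchy_convergent[OF Cauchy_trunc] by (simp add: dilation_def convergent_LIMSEQ_iff)

lemma dilation_unique: "(\<lambda>n. trunc n f) \<longlonglongrightarrow> F \<Longrightarrow> dilation f = F"
  using trunc_tendsto by (rule LIMSEQ_unique)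

lemma norm_dilation: "norm (dilation f) \<le> K * norm f"
  by (rule LIMSEQ_le_const2[OF tendsto_norm[OF trunc_tendsto]]) (auto simp: norm_trunc)

text \<open>The inner products with a total family, which determine \<open>dilation f\<close>. The
  case \<open>n = 0\<close> exhibits \<open>T\<close> as the compression of the dilation.\<close>

lemma cinner_dilation: "cinner_L2 (dilation f) (down n (of_H2 g)) = cinner_H2 (T ((T_p ^^ n) f)) g"
proof -
  have "(\<lambda>m. cinner_L2 (trunc m f) (down n (of_H2 g))) \<longlonglongrightarrow> cinner_L2 (trunc n f) (down n (of_H2 g))"
    by (intro tendsto_eventually eventually_sequentiallyI cinner_trunc_stable)
  with tendsto_cinner_left[OF trunc_tendsto]
  have "cinner_L2 (dilation f) (down n (of_H2 g)) = cinner_L2 (trunc n f) (down n (of_H2 g))"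
    by (rule LIMSEQ_unique)
  then show ?thesis
    by (simp add: trunc_def cinner_down_down cinner_H2.rep_eq)
qed

lemma T_p_power_add: "(T_p ^^ n) (f + g) = (T_p ^^ n) f + (T_p ^^ n) g"
  by (rule of_H2_inject[THEN iffD1])
    (simp only: of_H2_T_p_power plus_H2_G.rep_eq up_def mult_op_add up_Linfty)

lemma T_p_power_scaleC: "(T_p ^^ n) (scaleC_H2 c f) = scaleC_H2 c ((T_p ^^ n) f)"
  by (rule of_H2_inject[THEN iffD1])
    (simp only: of_H2_T_p_power scaleC_H2.rep_eq up_def mult_op_scaleC up_Linfty)

lemma dilation_add: "dilation (f + g) = dilation f + dilation g"
proof (rule dilation_unique)
  have "trunc n (f + g) = trunc n f + trunc n g" for n
    by (simp add: trunc_def T_p_power_add T_add plus_H2_G.rep_eq down_def mult_op_add down_Linfty)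
  then show "(\<lambda>n. trunc n (f + g)) \<longlonglongrightarrow> dilation f + dilation g"
    by (simp add: tendsto_add trunc_tendsto)
qed

lemma dilation_scaleC: "dilation (scaleC_H2 c f) = scaleC_L2 c (dilation f)"
proof (rule dilation_unique)
  have "trunc n (scaleC_H2 c f) = mult_op (\<lambda>_. c) (trunc n f)" for n
    by (simp add: trunc_def T_p_power_scaleC T_scaleC scaleC_H2.rep_eq down_def mult_op_scaleC
        down_Linfty mult_op_const)
  then show "(\<lambda>n. trunc n (scaleC_H2 c f)) \<longlonglongrightarrow> scaleC_L2 c (dilation f)"
    unfolding mult_op_const[symmetric] by (simp add: tendsto_mult_op Linfty_const trunc_tendsto)
qed

lemma dilation_diff: "dilation (f - g) = dilation f - dilation g"
  using dilation_add[of "f - g" g] by simp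

text \<open>Truncating \<open>p * f\<close> at \<open>n\<close> is \<open>p\<close> times the
  truncation of \<open>f\<close> at \<open>n + 1\<close>, and dropping the first term does not
  change the limit.\<close>

lemma dilation_T_p: "dilation (T_p f) = mult_op snd (dilation f)"
proof (rule dilation_unique)
  have "trunc n (T_p f) = mult_op snd (trunc (Suc n) f)" for n
  proof -
    have "mult_op snd (down (Suc n) F) = down n F" for F
      using down_up[of 1 "down n F"]
      by (simp add: down_def up_def mult_op_mult Linfty_cnj coordinates_Linfty down_Linfty Linfty_mult mult_ac)
    then show ?thesis
      by (simp add: trunc_def funpow_swap1)
  qed
  then show "(\<lambda>n. trunc n (T_p f)) \<longlonglongrightarrow> mult_op snd (dilation f)"
    by (simp add: tendsto_mult_op coordinates_Linfty LIMSEQ_Suc[OF trunc_tendsto])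
qed

lemma dilation_T_p_power: "dilation ((T_p ^^ n) f) = up n (dilation f)"
proof (induction n)
  case 0
  then show ?case
    by (simp add: up_def mult_op_one)
next
  case (Suc n)
  then show ?case
    by (simp add: dilation_T_p up_Suc)
qed

text \<open>Tested against \<open>cnj p ^ n * g\<close>, the factor \<open>s\<close> moves over as
  \<open>cnj s = cnj p * s\<close> and gives \<open>cnj p ^ (n + 1) * (s * g)\<close>. The surplus
  power of \<open>p\<close> is what \<open>rel_s\<close> consumes.\<close>

lemma dilation_T_s: "dilation (T_s f) = mult_op fst (dilation f)"
proof -
  have "cinner_L2 (dilation (T_s f) - mult_op fst (dilation f)) (down n (of_H2 g)) = 0" for n g
  proof -
    have "mult_op (\<lambda>x. cnj (fst x)) (down n F) = down (Suc n) (mult_op fst F)" for F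
      unfolding down_def
        mult_op_mult[OF Linfty_cnj[OF coordinates_Linfty(1)] down_Linfty]
        mult_op_mult[OF down_Linfty coordinates_Linfty(1)]
    proof (intro mult_op_cong Linfty_mult Linfty_cnj coordinates_Linfty down_Linfty)
      fix x assume x: "x \<in> bGamma"
      have "cnj (snd x) * fst x = cnj (fst x) * (cnj (snd x) * snd x)"
        using cnj_fst_mult_snd_bGamma[OF x] by (simp add: mult_ac)
      then have "cnj (fst x) = cnj (snd x) * fst x"
        by (simp add: cnj_snd_mult_snd_bGamma[OF x])
      then show "cnj (fst x) * cnj (snd x) ^ n = cnj (snd x) ^ Suc n * fst x"
        by simp
    qed
    then have "cinner_L2 (mult_op fst (dilation f)) (down n (of_H2 g)) =
        cinner_L2 (dilation f) (down (Suc n) (of_H2 (T_s g)))"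
      by (simp add: cinner_mult_op coordinates_Linfty of_H2_T_s)
    also have "\<dots> = cinner_H2 (T (T_p ((T_p ^^ n) f))) (T_s g)"
      by (simp add: cinner_dilation)
    also have "\<dots> = cinner_L2 (dilation (T_s f)) (down n (of_H2 g))"
      by (simp add: cinner_dilation rel_s T_p_T_s_commute)
    finally show ?thesis
      by (simp add: cinner_L2_diff_left)
  qed
  then have "dilation (T_s f) - mult_op fst (dilation f) = 0"
    by (rule down_H2_total)
  then show ?thesis
    by simp
qed

lemma dilation_poly:
  "q \<in> poly_bGamma \<Longrightarrow> \<exists>h. of_H2 h = mult_op q (of_H2 g) \<and> dilation h = mult_op q (dilation g)"
proof (induction arbitrary: g rule: poly_bGamma.induct)
  case (const c)
  show ?case
    by (rule exI[of _ "scaleC_H2 c g"]) (simp add: scaleC_H2.rep_eq mult_op_const dilation_scaleC)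
next
  case fst
  show ?case
    by (rule exI[of _ "T_s g"]) (simp add: of_H2_T_s dilation_T_s)
next
  case snd
  show ?case
    by (rule exI[of _ "T_p g"]) (simp add: of_H2_T_p dilation_T_p)
next
  case (add a b)
  obtain h k where "of_H2 h = mult_op a (of_H2 g)" "of_H2 k = mult_op b (of_H2 g)"
      "dilation h = mult_op a (dilation g)" "dilation k = mult_op b (dilation g)"
    using add.IH by blast
  then show ?case
    by (intro exI[of _ "h + k"]) (simp add: plus_H2_G.rep_eq dilation_add mult_op_plus poly_Linfty add.hyps)
next
  case (mult a b)
  obtain h where "of_H2 h = mult_op b (of_H2 g)" "dilation h = mult_op b (dilation g)"
    using mult.IH by blast
  moreover obtain k where "of_H2 k = mult_op a (of_H2 h)" "dilation k = mult_op a (dilation h)"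
    using mult.IH by blast
  ultimately show ?case
    by (intro exI[of _ k]) (simp add: mult_op_mult poly_Linfty mult.hyps)
qed

text \<open>The power of \<open>cnj p\<close> does not affect norms, and for the polynomial part the
  estimate is the bound of the dilation on H^2.\<close>

lemma norm_mult_dilation_one_le:
  assumes "laurent a" "a \<in> borel_measurable nu"
  shows "norm (mult_op a (dilation one_H2)) \<le> K * norm (mult_op a (of_H2 one_H2))"
proof -
  obtain n q where q: "q \<in> poly_bGamma" "\<And>x. x \<in> bGamma \<Longrightarrow> a x = cnj (snd x) ^ n * q x"
    using assms(1) by (auto simp: laurent_def)
  have a: "mult_op a F = down n (mult_op q F)" for F
    unfolding down_def mult_op_mult[OF down_Linfty poly_Linfty[OF q(1)]]
    by (intro mult_op_cong laurent_bounded assms Linfty_mult down_Linfty poly_Linfty q)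
  obtain h where "of_H2 h = mult_op q (of_H2 one_H2)" "dilation h = mult_op q (dilation one_H2)"
    using dilation_poly[OF q(1)] by blast
  then show ?thesis
    using norm_dilation[of h] by (simp add: a norm_down norm_H2_G.rep_eq)
qed


text \<open>
  Approximation of the indicator of \<open>{cmod \<phi> > K}\<close> takes place simultaneously in \<open>L\<^sup>2(nu)\<close>
  and in \<open>L\<^sup>2(\<bar>\<phi>\<bar>\<^sup>2 nu)\<close>.
\<close>

lemma dilation_one_bounded:
  assumes \<phi>: "square_integrable \<phi>" "dilation one_H2 = abs_L2_bGamma \<phi>"
  shows "AE x in nu. cmod (\<phi> x) \<le> K"
proof -
  have [measurable]: "\<phi> \<in> borel_measurable nu"
    using \<phi>(1) by (simp add: square_integrable_def)
  \<comment> \<open>Under this weight one mean square bound on \<open>r\<close> controls both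
    \<open>r\<close> and \<open>r * \<phi>\<close>. The weighted measure is finite since \<phi> is
    square integrable.\<close>
  define w where "w x = ennreal (1 + (cmod (\<phi> x))\<^sup>2)" for x
  have w [measurable]: "w \<in> borel_measurable nu"
    unfolding w_def by measurable
  interpret W: bGamma_measure "density nu w"
  proof (intro bGamma_measure.intro bGamma_measure_axioms.intro finite_measureI)
    have "integrable nu (\<lambda>x. 1 + (cmod (\<phi> x))\<^sup>2)"
      using \<phi>(1) by (auto simp: square_integrable_def)
    then have "(\<integral>\<^sup>+x. w x \<partial>nu) < \<infinity>"
      unfolding w_def by (subst nn_integral_eq_integral) auto
    moreover have "emeasure (density nu w) (space nu) = (\<integral>\<^sup>+x. w x \<partial>nu)"
      by (subst emeasure_density[OF w sets.top]) (intro nn_integral_cong, simp del: space_nu)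
    ultimately show "emeasure (density nu w) (space (density nu w)) \<noteq> \<infinity>"
      by simp
  qed simp
  define E where "E = {x \<in> space nu. K < cmod (\<phi> x)}"
  have E: "E \<in> sets nu"
    unfolding E_def by measurable
  define i where "i = (indicator E :: complex \<times> complex \<Rightarrow> complex)"
  have im [measurable]: "i \<in> borel_measurable nu"
    unfolding i_def by (rule borel_measurable_indicator[OF E])
  have iL: "i \<in> Linfty_bGamma"
    by (rule LinftyI[where B = 1, OF im]) (auto simp: i_def indicator_def)
  have one: "square_integrable (\<lambda>_. 1)"
    by (rule square_integrable_bounded[of _ 1]) auto
  have "norm (mult_op i (dilation one_H2)) \<le> K * norm (mult_op i (of_H2 one_H2)) + e" if e: "e > 0" for e
  proof -
    \<comment> \<open>Replacing the indicator by \<open>a\<close> costs \<open>d\<close> on the left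
      and \<open>K * d\<close> on the right.\<close>
    define d where "d = e / (K + 1)"
    have d: "d > 0"
      using e K by (simp add: d_def)
    obtain a where a: "laurent a" "a \<in> borel_measurable nu" "W.sq_norm (\<lambda>x. i x - a x) \<le> ennreal (d\<^sup>2)"
      using W.approximable_indicator_M[of E] E d
      unfolding W.approximable_def i_def by (auto dest!: spec[of _ "d\<^sup>2"])
    have aL: "a \<in> Linfty_bGamma"
      using laurent_bounded a by simp
    define r where "r x = i x - a x" for x
    have rL: "r \<in> Linfty_bGamma"
      using Linfty_add[OF iL Linfty_mult[OF Linfty_const[of "- 1"] aL]] by (simp add: r_def[abs_def])
    have [measurable]: "r \<in> borel_measurable nu"
      using rL by (rule Linfty_measurable)
    have i_eq: "mult_op i F = mult_op a F + mult_op r F" for F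
      unfolding mult_op_plus[OF aL rL, symmetric] by (simp add: r_def)
    \<comment> \<open>Stated for a general \<open>f\<close> in order to serve for \<open>r\<close>
      and for \<open>r * \<phi>\<close>.\<close>
    have small: "norm (abs_L2_bGamma f) \<le> d"
      if f: "f \<in> borel_measurable nu" "\<And>x. (cmod (f x))\<^sup>2 \<le> (1 + (cmod (\<phi> x))\<^sup>2) * (cmod (r x))\<^sup>2"
        and s: "square_integrable f" for f
    proof -
      have "(\<integral>\<^sup>+x. ennreal ((cmod (f x))\<^sup>2) \<partial>nu) \<le> (\<integral>\<^sup>+x. w x * ennreal ((cmod (r x))\<^sup>2) \<partial>nu)"
      proof (intro nn_integral_mono)
        fix x
        show "ennreal ((cmod (f x))\<^sup>2) \<le> w x * ennreal ((cmod (r x))\<^sup>2)"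
          using ennreal_leI[OF f(2)[of x]] unfolding w_def by (subst ennreal_mult[symmetric]) auto
      qed
      also have "\<dots> = W.sq_norm r"
        unfolding W.sq_norm_def by (subst nn_integral_density) measurable
      also have "\<dots> \<le> ennreal (d\<^sup>2)"
        using a(3) by (simp add: r_def[abs_def])
      finally have "ennreal (LINT x|nu. (cmod (f x))\<^sup>2) \<le> ennreal (d\<^sup>2)"
        using s by (subst (asm) nn_integral_eq_integral) (auto simp: square_integrable_def)
      then have "(LINT x|nu. (cmod (f x))\<^sup>2) \<le> d\<^sup>2"
        by (simp add: ennreal_le_iff)
      then have "(norm (abs_L2_bGamma f))\<^sup>2 \<le> d\<^sup>2"
        using norm_abs_L2[OF s] zero_le_power2[of "norm (abs_L2_bGamma f)"] by linarith
      then show ?thesis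
        by (rule power2_le_imp_le) (use d in simp)
    qed
    have r1: "norm (mult_op r (of_H2 one_H2)) \<le> d"
      unfolding of_H2_one mult_op_abs[OF rL one] mult_1_right
      by (rule small) (auto simp: Linfty_square_integrable rL distrib_right)
    have r\<phi>: "norm (mult_op r (dilation one_H2)) \<le> d"
      unfolding \<phi>(2) mult_op_abs[OF rL \<phi>(1)]
    proof (rule small)
      show "(cmod (r x * \<phi> x))\<^sup>2 \<le> (1 + (cmod (\<phi> x))\<^sup>2) * (cmod (r x))\<^sup>2" for x
        by (simp add: norm_mult power_mult_distrib distrib_right)
    qed (auto simp: Linfty_square_integrable_mult rL \<phi>(1))
    have "norm (mult_op i (dilation one_H2)) \<le> norm (mult_op a (dilation one_H2)) + d"
      unfolding i_eq using r\<phi> norm_triangle_le[OF add_left_mono] by blast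
    also have "\<dots> \<le> K * norm (mult_op a (of_H2 one_H2)) + d"
      using norm_mult_dilation_one_le[OF a(1,2)] by simp
    also have "\<dots> \<le> K * (norm (mult_op i (of_H2 one_H2)) + d) + d"
    proof -
      have "mult_op a (of_H2 one_H2) = mult_op i (of_H2 one_H2) - mult_op r (of_H2 one_H2)"
        by (simp add: i_eq)
      then have "norm (mult_op a (of_H2 one_H2)) \<le> norm (mult_op i (of_H2 one_H2)) + norm (mult_op r (of_H2 one_H2))"
        by (simp only: norm_triangle_ineq4)
      then show ?thesis
        using r1 K by (intro add_right_mono mult_left_mono) auto
    qed
    also have "\<dots> = K * norm (mult_op i (of_H2 one_H2)) + (K + 1) * d"
      by (simp add: algebra_simps)
    also have "(K + 1) * d = e"
      using K by (simp add: d_def)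
    finally show ?thesis .
  qed
  then have "norm (mult_op i (dilation one_H2)) \<le> K * norm (mult_op i (of_H2 one_H2))"
    by (rule field_le_epsilon)
  then have "(norm (mult_op i (dilation one_H2)))\<^sup>2 \<le> (K * norm (mult_op i (of_H2 one_H2)))\<^sup>2"
    by (rule power_mono) simp
  then have "(norm (abs_L2_bGamma (\<lambda>x. i x * \<phi> x)))\<^sup>2 \<le> K\<^sup>2 * (norm (abs_L2_bGamma i))\<^sup>2"
    by (simp add: of_H2_one \<phi> mult_op_abs iL one power_mult_distrib)
  then have le: "(LINT x|nu. (cmod (i x * \<phi> x))\<^sup>2) \<le> K\<^sup>2 * (LINT x|nu. (cmod (i x))\<^sup>2)"
    by (simp add: norm_abs_L2 Linfty_square_integrable Linfty_square_integrable_mult iL \<phi>(1))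
  \<comment> \<open>This is \<open>|\<phi>|^2 - K^2\<close> on \<open>E\<close> and 0 elsewhere. It
    is positive on \<open>E\<close> but has integral at most 0, so \<open>E\<close> is a null
    set.\<close>
  define g where "g x = (cmod (i x * \<phi> x))\<^sup>2 - K\<^sup>2 * (cmod (i x))\<^sup>2" for x
  have int: "integrable nu (\<lambda>x. (cmod (i x * \<phi> x))\<^sup>2)" "integrable nu (\<lambda>x. K\<^sup>2 * (cmod (i x))\<^sup>2)"
    using Linfty_square_integrable[OF iL] Linfty_square_integrable_mult[OF iL \<phi>(1)]
    by (auto simp: square_integrable_def)
  have g_pos: "0 < g x" if "x \<in> E" for x
    using that K power_strict_mono[of K "cmod (\<phi> x)" 2] by (simp add: g_def i_def E_def)
  have g_nonneg: "0 \<le> g x" for x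
    using g_pos[of x] by (cases "x \<in> E") (auto simp: g_def i_def)
  have "(LINT x|nu. g x) \<le> 0"
    unfolding g_def using le by (simp add: Bochner_Integration.integral_diff[OF int])
  moreover have "(LINT x|nu. g x) \<ge> 0"
    using g_nonneg by (intro Bochner_Integration.integral_nonneg)
  moreover have "integrable nu g"
    unfolding g_def by (rule Bochner_Integration.integrable_diff[OF int])
  ultimately have "AE x in nu. g x = 0"
    using integral_nonneg_eq_0_iff_AE[of nu g, OF _ AE_I2[OF g_nonneg]] by auto
  with AE_space show ?thesis
  proof eventually_elim
    case (elim x)
    then show ?case
      using g_pos[of x] by (auto simp: E_def not_less[symmetric])
  qed
qed

text \<open>On polynomials the dilation is multiplication by its value at 1. Both operators being
  bounded by \<open>K\<close>, this extends to H^2, and compression returns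
  \<open>T\<close>.\<close>

lemma exists_symbol: "\<exists>\<phi>\<in>Linfty_bGamma. T = toeplitz \<phi>"
proof -
  obtain \<phi> where \<phi>: "square_integrable \<phi>" "dilation one_H2 = abs_L2_bGamma \<phi>"
    by (rule L2_cases)
  have bound: "AE x in nu. cmod (\<phi> x) \<le> K"
    by (rule dilation_one_bounded[OF \<phi>])
  have L: "\<phi> \<in> Linfty_bGamma"
    using \<phi>(1) bound by (auto simp: Linfty_bGamma_def square_integrable_def)
  have one: "square_integrable (\<lambda>_. 1)"
    by (rule square_integrable_bounded[of _ 1]) auto
  have dil1: "dilation one_H2 = mult_op \<phi> (of_H2 one_H2)"
    by (simp add: \<phi> of_H2_one mult_op_abs L one)
  have "norm (dilation h - mult_op \<phi> (of_H2 h)) \<le> 0 + e" if e: "e > 0" for h e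
  proof -
    \<comment> \<open>Two errors of size \<open>K * d\<close> add up to \<open>e\<close>: one from
      the dilation, one from multiplication by \<phi>.\<close>
    define d where "d = e / (2 * K)"
    have d: "d > 0"
      using e K by (simp add: d_def)
    obtain n q where q: "q \<in> poly_bGamma" "norm (of_H2 h - down n (mult_op q (of_H2 one_H2))) \<le> d"
      using laurent_dense[OF d] by blast
    obtain g where g: "of_H2 g = mult_op q (of_H2 one_H2)" "dilation g = mult_op q (dilation one_H2)"
      using dilation_poly[OF q(1)] by blast
    have close: "norm (of_H2 h - down n (of_H2 g)) \<le> d"
      using q(2) by (simp add: g(1))
    have dil_g: "dilation g = mult_op \<phi> (of_H2 g)"
      by (simp add: g dil1 mult_op_commute[OF poly_Linfty[OF q(1)] L])
    \<comment> \<open>\<open>down n (of_H2 g)\<close> need not lie in H^2, where alone the dilation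
      is defined. Multiplication by \<open>p ^ n\<close> preserves the norm and turns the difference
      into the dilation of an element of H^2.\<close>
    have "norm (dilation h - down n (dilation g)) = norm (up n (dilation h - down n (dilation g)))"
      by (rule norm_up[symmetric])
    also have "\<dots> = norm (dilation ((T_p ^^ n) h - g))"
      by (simp add: up_diff up_down dilation_diff dilation_T_p_power)
    also have "\<dots> \<le> K * norm ((T_p ^^ n) h - g)"
      by (rule norm_dilation)
    also have "norm ((T_p ^^ n) h - g) = norm (up n (of_H2 h - down n (of_H2 g)))"
      by (simp add: norm_H2_G.rep_eq minus_H2_G.rep_eq of_H2_T_p_power up_diff up_down)
    also have "K * \<dots> \<le> K * d"
      using close K by (intro mult_left_mono) (auto simp: norm_up)
    finally have 1: "norm (dilation h - down n (dilation g)) \<le> K * d" .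
    have "down n (dilation g) = mult_op \<phi> (down n (of_H2 g))"
      unfolding dil_g down_def by (rule mult_op_commute[OF down_Linfty L])
    then have "norm (down n (dilation g) - mult_op \<phi> (of_H2 h)) =
        norm (mult_op \<phi> (down n (of_H2 g) - of_H2 h))"
      by (simp add: mult_op_diff[OF L])
    also have "\<dots> \<le> K * norm (down n (of_H2 g) - of_H2 h)"
      using K by (intro norm_mult_op_le L bound) simp
    also have "\<dots> \<le> K * d"
      using close K by (intro mult_left_mono) (auto simp: norm_minus_commute)
    finally have 2: "norm (down n (dilation g) - mult_op \<phi> (of_H2 h)) \<le> K * d" .
    have "norm (dilation h - mult_op \<phi> (of_H2 h)) \<le> K * d + K * d"
      using norm_diff_triangle_le[OF 1 2] .
    then show ?thesis
      using K by (simp add: d_def)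
  qed
  then have "norm (dilation h - mult_op \<phi> (of_H2 h)) \<le> 0" for h
    by (rule field_le_epsilon)
  then have dil: "dilation h = mult_op \<phi> (of_H2 h)" for h
    by simp
  have "T h = toeplitz \<phi> h" for h
  proof (rule cinner_H2_eqI)
    fix g
    show "cinner_H2 (T h) g = cinner_H2 (toeplitz \<phi> h) g"
      using cinner_dilation[of h 0 g] by (simp add: cinner_toeplitz dil down_0)
  qed
  then show ?thesis
    using L by blast
qed

end

theorem theorem2:
  fixes T :: "H2_G \<Rightarrow> H2_G"
  assumes "bounded_operator T"
  shows "(\<exists>\<phi>\<in>Linfty_bGamma. T = toeplitz \<phi>) \<longleftrightarrow>
           adjoint_H2 T_s \<circ> T \<circ> T_p = T \<circ> T_s \<and> adjoint_H2 T_p \<circ> T \<circ> T_p = T"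
proof
  assume "\<exists>\<phi>\<in>Linfty_bGamma. T = toeplitz \<phi>"
  then show "adjoint_H2 T_s \<circ> T \<circ> T_p = T \<circ> T_s \<and> adjoint_H2 T_p \<circ> T \<circ> T_p = T"
    by (elim bexE) (simp only: toeplitz_brown_halmos)
next
  assume rel: "adjoint_H2 T_s \<circ> T \<circ> T_p = T \<circ> T_s \<and> adjoint_H2 T_p \<circ> T \<circ> T_p = T"
  interpret T: bounded_linear T
    using assms by (simp add: bounded_operator_def)
  \<comment> \<open>Not necessarily the operator norm; what matters is positivity, since tolerances
    are divided by \<open>K\<close>.\<close>
  obtain K where K: "K > 0" "\<And>f. norm (T f) \<le> norm f * K"
    using T.pos_bounded by blast
  interpret brown_halmos T K
    using rel[unfolded brown_halmos_iff] assms K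
    by unfold_locales (auto simp: bounded_operator_def T.add mult.commute)
  show "\<exists>\<phi>\<in>Linfty_bGamma. T = toeplitz \<phi>"
    by (rule exists_symbol)
qed

end
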